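(* The maps $\operatorname{DTS}$ and $\operatorname{DTR}$ are bijections from the set of integer sequences $(p_1,\dots,p_n)$ with $0\le p_i\le 2(i-1)$ for all $i$ to the set of cover-inclusive Dyck tilings of order $n$.
   Context: Dyck paths. A Dyck path of order $n$ is a lattice path from $(-n,0)$ to $(n,0)$ with steps $(+1,+1)$ (up) and $(+1,-1)$ (down) never going below the $x$-axis; $\rho(x)$ is its height at $x$. Column $s$ means the vertical line $x=s$. Dyck tilings. A box is a square with vertices $(x,y),(x+1,y+1),(x,y+2),(x-1,y+1)$; $(x,y)$ is its lower corner and it lies in column $x$. For Dyck paths $\lambda,\mu$ of order $n$ with $\mu(x)\ge\lambda(x)$ for all $x$, the skew shape $\lambda/\mu$ is the set of boxes between them. A Dyck tile is a nonempty set of boxes, one in each of a set of consecutive columns, whose lower corners, read left to right, form a lattice path with steps $(+1,\pm1)$ whose first and last points have the same height and no point lower than them. A Dyck tiling of $\lambda/\mu$ is a partition of its boxes into Dyck tiles (lower path $\lambda$, upper path $\mu$, order $n$; the empty tiling of order $0$ has $\lambda=\mu=\{(0,0)\}$). Tile $A$ covers tile $B$ if some box of $A$ lies directly above some box of $B$; the tiling is cover-inclusive if whenever $A$ covers $B$ the set of columns of $A$ is contained in that of $B$. Spread. The spread at column $s$ of a path $\rho$ (a set of lattice points) is $\{(x-1,y):(x,y)\in\rho,x\le s\}\cup\{(x,y+1):(x,y)\in\rho,x=s\}\cup\{(x+1,y):(x,y)\in\rho,x\ge s\}$; the spread of a tile spreads its lower-corner path; the spread of a tiling spreads its lower path, upper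 path and all tiles. Special column. For a Dyck tiling $T$ with upper path $\mu$, column $s$ is eligible if $\mu$ has an up step ending in column $s$ and the point of $\mu$ at column $s$ is not the top corner of a one-box tile of $T$; the special column is the rightmost eligible column. Grow maps. For a Dyck tiling $T$ of order $n$ and $-n\le s\le n$, let $T''$ be the spread of $T$ at $s$, with upper path $\mu''$. $\mathrm{sgrow}(T,s)$ is $T''$ together with, for every up step of $\mu''$ from $(a,h)$ to $(a+1,h+1)$ with $a\ge s$, the one-box tile with lower corner $(a,h)$. $\mathrm{rgrow}(T,s)$: if the special column $Q$ of $T''$ satisfies $Q>s$, it is $T''$ together with, for each column $c$ with $s<c<Q$, the one-box tile with lower corner $(c,\mu''(c))$; otherwise it is $T''$. DTS and DTR. $\operatorname{DTS}()=\operatorname{DTR}()=$ the empty tiling of order $0$; $\operatorname{DTS}(p_1,\dots,p_n)=\mathrm{sgrow}(\operatorname{DTS}(p_1,\dots,p_{n-1}),p_n-(n-1))$ and $\operatorname{DTR}(p_1,\dots,p_n)=\mathrm{rgrow}(\operatorname{DTR}(p_1,\dots,p_{n-1}),p_n-(n-1))$. *)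

theory Defs
  imports Complex_Main "HOL-Library.Disjoint_Sets"
begin

type_synonym point = "int \<times> int"

definition lattice_path :: "int \<Rightarrow> int \<Rightarrow> point set \<Rightarrow> bool" where
  "lattice_path a b P \<longleftrightarrow> a \<le> b \<and>
     (\<exists>h. P = {(x, h x) | x. a \<le> x \<and> x \<le> b} \<and>
          (\<forall>x. a \<le> x \<and> x < b \<longrightarrow> h (x + 1) = h x + 1 \<or> h (x + 1) = h x - 1))"

definition dyck_path :: "nat \<Rightarrow> point set \<Rightarrow> bool" where
  "dyck_path n P \<longleftrightarrow> lattice_path (- int n) (int n) P \<and>
     (- int n, 0) \<in> P \<and> (int n, 0) \<in> P \<and> (\<forall>(x, y)\<in>P. 0 \<le> y)"

definition path_le :: "point set \<Rightarrow> point set \<Rightarrow> bool" where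
  "path_le L M \<longleftrightarrow> (\<forall>x y y'. (x, y) \<in> L \<and> (x, y') \<in> M \<longrightarrow> y \<le> y')"

text \<open>
  A box is represented by its lower corner, so that tiles, like paths, are sets of points.
  The vertices of the boxes considered are lattice points of the same parity as the points of
  the two paths; this is the purpose of the evenness condition.
\<close>

definition box_vertices :: "point \<Rightarrow> point set" where
  "box_vertices = (\<lambda>(x, y). {(x, y), (x + 1, y + 1), (x, y + 2), (x - 1, y + 1)})"

definition points_between :: "point set \<Rightarrow> point set \<Rightarrow> point set" where
  "points_between L M =
     {(x, v) | x v. \<exists>a b. (x, a) \<in> L \<and> (x, b) \<in> M \<and> a \<le> v \<and> v \<le> b \<and> even (v - a)}"

definition skew_shape :: "point set \<Rightarrow> point set \<Rightarrow> point set" where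
  "skew_shape L M = {c. box_vertices c \<subseteq> points_between L M}"

definition dyck_tile :: "point set \<Rightarrow> bool" where
  "dyck_tile t \<longleftrightarrow> (\<exists>a b m. lattice_path a b t \<and> (a, m) \<in> t \<and> (b, m) \<in> t \<and> (\<forall>(x, y)\<in>t. m \<le> y))"

datatype tiling =
  Tiling (lower: "point set") (upper: "point set") (tiles: "point set set")

definition dyck_tiling :: "nat \<Rightarrow> tiling \<Rightarrow> bool" where
  "dyck_tiling n T \<longleftrightarrow> dyck_path n (lower T) \<and> dyck_path n (upper T) \<and>
     path_le (lower T) (upper T) \<and>
     partition_on (skew_shape (lower T) (upper T)) (tiles T) \<and>
     (\<forall>t\<in>tiles T. dyck_tile t)"

text \<open>
  Here \<open>directly above\<close> means adjacent in the same column. Allowing arbitrary vertical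
  distance yields the same cover-inclusive tilings: the boxes of a skew shape in a given column
  are consecutive, and inclusion of sets of columns is transitive.
\<close>

definition covers :: "point set \<Rightarrow> point set \<Rightarrow> bool" where
  "covers A B \<longleftrightarrow> (\<exists>x y. (x, y) \<in> B \<and> (x, y + 2) \<in> A)"

definition cover_inclusive :: "tiling \<Rightarrow> bool" where
  "cover_inclusive T \<longleftrightarrow> (\<forall>A\<in>tiles T. \<forall>B\<in>tiles T. covers A B \<longrightarrow> fst ` A \<subseteq> fst ` B)"

definition spread :: "int \<Rightarrow> point set \<Rightarrow> point set" where
  "spread s P = {(x - 1, y) | x y. (x, y) \<in> P \<and> x \<le> s} \<union>
                {(x, y + 1) | x y. (x, y) \<in> P \<and> x = s} \<union>
                {(x + 1, y) | x y. (x, y) \<in> P \<and> s \<le> x}"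

definition spread_tiling :: "int \<Rightarrow> tiling \<Rightarrow> tiling" where
  "spread_tiling s T = Tiling (spread s (lower T)) (spread s (upper T)) (spread s ` tiles T)"

definition up_step :: "point set \<Rightarrow> int \<Rightarrow> int \<Rightarrow> bool" where
  "up_step P x y \<longleftrightarrow> (x, y) \<in> P \<and> (x + 1, y + 1) \<in> P"

definition eligible :: "tiling \<Rightarrow> int \<Rightarrow> bool" where
  "eligible T s \<longleftrightarrow> (\<exists>h. up_step (upper T) (s - 1) (h - 1) \<and> {(s, h - 2)} \<notin> tiles T)"

text \<open>
  The maximum is meaningful only if some column is eligible. This is the case for the spread at
  \<open>s\<close> of a tiling whose upper path meets column \<open>s\<close>: column \<open>s\<close> itself is
  eligible, since no spread tile with a box in that column consists of a single box.
\<close>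

definition special_column :: "tiling \<Rightarrow> int" where
  "special_column T = Max {s. eligible T s}"

text \<open>
  Adds the one-box tiles with lower corners in \<open>B\<close>, a set of points of the upper path.
  The new upper path passes through the top corners of the added boxes instead of their
  lower corners.
\<close>

definition add_boxes :: "point set \<Rightarrow> tiling \<Rightarrow> tiling" where
  "add_boxes B T = Tiling (lower T)
     ((upper T - B) \<union> {(x, y + 2) | x y. (x, y) \<in> B})
     (tiles T \<union> {{c} | c. c \<in> B})"

definition sgrow :: "tiling \<Rightarrow> int \<Rightarrow> tiling" where
  "sgrow T s = (let T' = spread_tiling s T in
     add_boxes {(a, h) | a h. up_step (upper T') a h \<and> s \<le> a} T')"

definition rgrow :: "tiling \<Rightarrow> int \<Rightarrow> tiling" where
  "rgrow T s = (let T' = spread_tiling s T; Q = special_column T' in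
     if Q > s then add_boxes {(c, h) | c h. (c, h) \<in> upper T' \<and> s < c \<and> c < Q} T'
     else T')"

definition empty_tiling :: tiling where
  "empty_tiling = Tiling {(0, 0)} {(0, 0)} {}"

text \<open>
  The lists are consumed from the right; the lemmas \<open>DTS_snoc\<close> and \<open>DTR_snoc\<close>
  below give the recursion equations.
\<close>

fun DTS :: "int list \<Rightarrow> tiling" where
  "DTS ps = (if ps = [] then empty_tiling
             else sgrow (DTS (butlast ps)) (last ps - int (length (butlast ps))))"

fun DTR :: "int list \<Rightarrow> tiling" where
  "DTR ps = (if ps = [] then empty_tiling
             else rgrow (DTR (butlast ps)) (last ps - int (length (butlast ps))))"

declare DTS.simps [simp del] DTR.simps [simp del]

lemma DTS_Nil [simp]: "DTS [] = empty_tiling"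
  by (simp add: DTS.simps)

lemma DTS_snoc [simp]: "DTS (ps @ [p]) = sgrow (DTS ps) (p - int (length ps))"
  by (simp add: DTS.simps [of "ps @ [p]"])

lemma DTR_Nil [simp]: "DTR [] = empty_tiling"
  by (simp add: DTR.simps)

lemma DTR_snoc [simp]: "DTR (ps @ [p]) = rgrow (DTR ps) (p - int (length ps))"
  by (simp add: DTR.simps [of "ps @ [p]"])

text \<open>With list indices starting at 0, the bound on the \<open>i\<close>th entry is \<open>2 * i\<close>.\<close>

definition growth_sequences :: "nat \<Rightarrow> int list set" where
  "growth_sequences n = {ps. length ps = n \<and> (\<forall>i<n. 0 \<le> ps ! i \<and> ps ! i \<le> 2 * int i)}"

definition cover_inclusive_tilings :: "nat \<Rightarrow> tiling set" where
  "cover_inclusive_tilings n = {T. dyck_tiling n T \<and> cover_inclusive T}"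

end

theory Submission
  imports Defs
begin

text \<open>
  Spreading at column \<open>s\<close> is taking preimages under a surjection of the plane that collapses the
  columns \<open>s - 1\<close>, \<open>s\<close>, \<open>s + 1\<close> into one. It is therefore injective and preserves and reflects
  partitions, tiles and the covering relation. Its image consists of the cover-inclusive tilings
  whose upper path has a peak at the eligible column \<open>s\<close>: there the topmost tile in column \<open>s\<close> must
  itself have a peak at \<open>s\<close>, and by cover-inclusiveness so do all tiles below it. The boxes added
  afterwards by either grow map make \<open>s\<close> the special column and can be recognised in the
  result: they are the boxes below the ends of up steps right of \<open>s\<close> for the one map, and the
  maximal run of one-box tiles along the upper path right of \<open>s\<close>, present only if an up step
  leaves column \<open>s\<close>, for the other. So each grow map is a bijection from pairs of a tiling of
  order \<open>n\<close> and a column onto the tilings of order \<open>n + 1\<close>.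
\<close>

section \<open>Height functions of paths and tilings\<close>

text \<open>A total height function stands for a path or a tile, which turns geometric conditions
  into integer arithmetic. Its values outside the columns \<open>a\<close> to \<open>b\<close> are
  arbitrary, so one set has many height functions.\<close>

definition graph_on :: "int \<Rightarrow> int \<Rightarrow> (int \<Rightarrow> int) \<Rightarrow> point set" where
  "graph_on a b h = {(x, h x) | x. a \<le> x \<and> x \<le> b}"

definition unit_steps :: "int \<Rightarrow> int \<Rightarrow> (int \<Rightarrow> int) \<Rightarrow> bool" where
  "unit_steps a b h \<longleftrightarrow> (\<forall>x. a \<le> x \<and> x < b \<longrightarrow> h (x + 1) = h x + 1 \<or> h (x + 1) = h x - 1)"

definition dyck_fun :: "nat \<Rightarrow> (int \<Rightarrow> int) \<Rightarrow> bool" where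
  "dyck_fun n h \<longleftrightarrow> unit_steps (- int n) (int n) h \<and> h (- int n) = 0 \<and> h (int n) = 0 \<and>
     (\<forall>x. - int n \<le> x \<and> x \<le> int n \<longrightarrow> 0 \<le> h x)"

text \<open>Closed form of the skew shape between two Dyck paths: only the lower and the upper
  corner of a box are compared with the paths.\<close>

definition region :: "nat \<Rightarrow> (int \<Rightarrow> int) \<Rightarrow> (int \<Rightarrow> int) \<Rightarrow> point set" where
  "region n l m = {(x, y). - int n \<le> x \<and> x \<le> int n \<and> l x \<le> y \<and> y + 2 \<le> m x \<and> even (y - l x)}"

definition ci_data :: "nat \<Rightarrow> (int \<Rightarrow> int) \<Rightarrow> (int \<Rightarrow> int) \<Rightarrow> point set set \<Rightarrow> bool" where
  "ci_data n l m X \<longleftrightarrow> dyck_fun n l \<and> dyck_fun n m \<and>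
     (\<forall>x. - int n \<le> x \<and> x \<le> int n \<longrightarrow> l x \<le> m x) \<and>
     partition_on (region n l m) X \<and> (\<forall>t\<in>X. dyck_tile t) \<and>
     (\<forall>A\<in>X. \<forall>B\<in>X. covers A B \<longrightarrow> fst ` A \<subseteq> fst ` B)"

definition tiling_of :: "nat \<Rightarrow> (int \<Rightarrow> int) \<Rightarrow> (int \<Rightarrow> int) \<Rightarrow> point set set \<Rightarrow> tiling" where
  "tiling_of n l m X = Tiling (graph_on (- int n) (int n) l) (graph_on (- int n) (int n) m) X"

lemma tiling_of_sel [simp]:
  "lower (tiling_of n l m X) = graph_on (- int n) (int n) l"
  "upper (tiling_of n l m X) = graph_on (- int n) (int n) m"
  "tiles (tiling_of n l m X) = X"
  by (simp_all add: tiling_of_def)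

lemma mem_graph_on [simp]: "(x, y) \<in> graph_on a b h \<longleftrightarrow> a \<le> x \<and> x \<le> b \<and> y = h x"
  by (auto simp: graph_on_def)

lemma lattice_path_iff:
  "lattice_path a b P \<longleftrightarrow> a \<le> b \<and> (\<exists>h. P = graph_on a b h \<and> unit_steps a b h)"
  by (simp add: lattice_path_def graph_on_def unit_steps_def)

lemma unit_steps_cong:
  assumes "unit_steps a b g" and "\<And>x. a \<le> x \<Longrightarrow> x \<le> b \<Longrightarrow> g x = h x"
  shows "unit_steps a b h"
  unfolding unit_steps_def
proof (intro allI impI)
  fix x assume "a \<le> x \<and> x < b"
  then show "h (x + 1) = h x + 1 \<or> h (x + 1) = h x - 1"
    using assms(1)[unfolded unit_steps_def, rule_format, of x] assms(2)[of x] assms(2)[of "x + 1"]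
    by auto
qed

text \<open>Height functions with the same graph agree on the columns \<open>a\<close> to
  \<open>b\<close>, so the steps can be read off any of them.\<close>

lemma lattice_path_graph_on:
  "lattice_path a b (graph_on a b h) \<longleftrightarrow> a \<le> b \<and> unit_steps a b h"
proof -
  have "g x = h x" if "graph_on a b h = graph_on a b g" "a \<le> x" "x \<le> b" for g x
    using that mem_graph_on by blast
  then show ?thesis
    unfolding lattice_path_iff using unit_steps_cong by metis
qed

lemma dyck_path_graph_on: "dyck_path n (graph_on (- int n) (int n) h) \<longleftrightarrow> dyck_fun n h"
  by (auto simp: dyck_path_def lattice_path_graph_on dyck_fun_def)

lemma dyck_path_iff: "dyck_path n P \<longleftrightarrow> (\<exists>h. P = graph_on (- int n) (int n) h \<and> dyck_fun n h)"
  by (metis dyck_path_graph_on dyck_path_def lattice_path_iff)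

lemma dyck_tile_iff:
  "dyck_tile t \<longleftrightarrow> (\<exists>a b h. a \<le> b \<and> t = graph_on a b h \<and> unit_steps a b h \<and> h a = h b \<and>
     (\<forall>x. a \<le> x \<and> x \<le> b \<longrightarrow> h a \<le> h x))" (is "?L = ?R")
proof
  assume ?L
  then show ?R unfolding dyck_tile_def lattice_path_iff by fastforce
next
  assume ?R
  then obtain a b h where h: "a \<le> b" "t = graph_on a b h" "unit_steps a b h" "h a = h b"
      "\<forall>x. a \<le> x \<and> x \<le> b \<longrightarrow> h a \<le> h x" by blast
  then have "lattice_path a b t \<and> (a, h a) \<in> t \<and> (b, h a) \<in> t \<and> (\<forall>(x, y)\<in>t. h a \<le> y)"
    by (auto simp: lattice_path_graph_on)
  then show ?L unfolding dyck_tile_def by blast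
qed

lemma dyck_tile_graph_on:
  assumes "a \<le> b" "unit_steps a b h" "h a = h b" "\<And>x. a \<le> x \<Longrightarrow> x \<le> b \<Longrightarrow> h a \<le> h x"
  shows "dyck_tile (graph_on a b h)"
  unfolding dyck_tile_iff using assms by blast

lemma unit_steps_parity:
  assumes "unit_steps a b h" "a \<le> x" "x \<le> b"
  shows "even (h x - h a - (x - a))"
  using assms(2,3)
proof (induction x rule: int_ge_induct)
  case (step x)
  then have "h (x + 1) = h x + 1 \<or> h (x + 1) = h x - 1"
    using assms(1) by (simp add: unit_steps_def)
  then show ?case using step by presburger
qed simp

text \<open>Both paths start at height 0, and every step flips the parity of the height.\<close>

lemma dyck_fun_parity:
  assumes "dyck_fun n l" "dyck_fun n m" "- int n \<le> x" "x \<le> int n"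
  shows "even (m x - l x)"
proof -
  have "even (h x - (x + int n))" if "dyck_fun n h" for h
    using unit_steps_parity[of "- int n" "int n" h x] that assms(3,4) by (simp add: dyck_fun_def)
  from this[OF assms(1)] this[OF assms(2)] show ?thesis by presburger
qed

lemma dyck_fun_step:
  assumes "dyck_fun n h" "- int n \<le> x" "x < int n"
  shows "h (x + 1) = h x + 1 \<or> h (x + 1) = h x - 1"
  using assms by (auto simp: dyck_fun_def unit_steps_def)

text \<open>A step changes a height by only 1, so the side corners of a box lie between the paths as
  soon as its lower and upper corners do.\<close>

lemma skew_shape_graph_on:
  assumes l: "dyck_fun n l" and m: "dyck_fun n m"
  shows "skew_shape (graph_on (- int n) (int n) l) (graph_on (- int n) (int n) m) = region n l m"
    (is "?S = _")
proof -
  have "(x, y) \<in> ?S \<longleftrightarrow> (x, y) \<in> region n l m" for x y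
  proof
    assume "(x, y) \<in> ?S"
    then show "(x, y) \<in> region n l m"
      by (auto simp: skew_shape_def box_vertices_def points_between_def region_def)
  next
    assume r: "(x, y) \<in> region n l m"
    \<comment> \<open>The paths meet at height 0 in the two outermost columns, which leaves no room
      for a box there; hence both neighbouring columns exist.\<close>
    then have "x \<noteq> - int n" "x \<noteq> int n"
      using l m by (auto simp: region_def dyck_fun_def)
    then have x: "- int n < x" "x < int n" using r by (auto simp: region_def)
    note st = dyck_fun_step[OF l, of x] dyck_fun_step[OF l, of "x - 1"]
      dyck_fun_step[OF m, of x] dyck_fun_step[OF m, of "x - 1"]
    show "(x, y) \<in> ?S"
      using r x st
      by (simp add: skew_shape_def box_vertices_def points_between_def region_def) presburger
  qed
  then show ?thesis by auto
qed

lemma ci_tiling_of: "tiling_of n l m X \<in> cover_inclusive_tilings n \<longleftrightarrow> ci_data n l m X"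
proof -
  have "path_le (graph_on (- int n) (int n) l) (graph_on (- int n) (int n) m) \<longleftrightarrow>
      (\<forall>x. - int n \<le> x \<and> x \<le> int n \<longrightarrow> l x \<le> m x)"
    by (auto simp: path_le_def)
  then show ?thesis
    by (auto simp: cover_inclusive_tilings_def dyck_tiling_def cover_inclusive_def ci_data_def
        dyck_path_graph_on skew_shape_graph_on)
qed

lemma ci_tilingE:
  assumes "T \<in> cover_inclusive_tilings n"
  obtains l m X where "T = tiling_of n l m X" "ci_data n l m X"
proof -
  obtain l m where "lower T = graph_on (- int n) (int n) l" "upper T = graph_on (- int n) (int n) m"
    using assms by (auto simp: cover_inclusive_tilings_def dyck_tiling_def dyck_path_iff)
  then have "T = tiling_of n l m (tiles T)"
    by (simp add: tiling_of_def tiling.expand)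
  then show thesis using that assms ci_tiling_of by metis
qed

section \<open>Spreading and contracting a column\<close>

text \<open>The spread replaces \<open>(s, y)\<close> by \<open>(s - 1, y)\<close>,
  \<open>(s, y + 1)\<close> and \<open>(s + 1, y)\<close>. This map sends all three back to
  \<open>(s, y)\<close> and moves every other point back by one column.\<close>

definition contract_pt :: "int \<Rightarrow> point \<Rightarrow> point" where
  "contract_pt s = (\<lambda>(x, y). if x < s then (x + 1, y) else if x = s then (x, y - 1) else (x - 1, y))"

definition spread_fun :: "int \<Rightarrow> (int \<Rightarrow> int) \<Rightarrow> int \<Rightarrow> int" where
  "spread_fun s h x = (if x < s then h (x + 1) else if x = s then h x + 1 else h (x - 1))"

text \<open>Column \<open>s\<close> receives the value at \<open>s - 1\<close>; when
  \<open>h\<close> has a peak at \<open>s\<close>, the value at \<open>s + 1\<close> is the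
  same.\<close>

definition contract_fun :: "int \<Rightarrow> (int \<Rightarrow> int) \<Rightarrow> int \<Rightarrow> int" where
  "contract_fun s h x = (if x \<le> s then h (x - 1) else h (x + 1))"

lemma spread_eq_vimage: "spread s P = contract_pt s -` P"
  by (auto simp: spread_def contract_pt_def split: if_splits) (smt (verit))+

lemma mem_spread:
  "(x, y) \<in> spread s P \<longleftrightarrow>
     (if x < s then (x + 1, y) \<in> P else if x = s then (x, y - 1) \<in> P else (x - 1, y) \<in> P)"
  by (simp add: spread_eq_vimage contract_pt_def)

lemma contract_pt_left: "x \<le> s \<Longrightarrow> contract_pt s (x - 1, y) = (x, y)"
  and contract_pt_right: "x \<ge> s \<Longrightarrow> contract_pt s (x + 1, y) = (x, y)"
  by (auto simp: contract_pt_def)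

lemma surj_contract_pt: "surj (contract_pt s)"
  by (metis contract_pt_left contract_pt_right linear surjI surj_def surj_pair)

lemma spread_inject: "spread s P = spread s P' \<longleftrightarrow> P = P'"
  using surj_contract_pt by (metis spread_eq_vimage surj_image_vimage_eq)

lemma spread_tiling_inject: "spread_tiling s T = spread_tiling s T' \<longleftrightarrow> T = T'"
  by (auto simp: spread_tiling_def spread_inject inj_image_eq_iff inj_def tiling.expand)

text \<open>The hypotheses say that \<open>P\<close> contains all or none of each three-point fibre
  of \<open>contract_pt s\<close>; the other fibres are single points. Such a set is the preimage of
  its image.\<close>

lemma spread_contract:
  assumes "\<And>y. (s - 1, y) \<in> P \<longleftrightarrow> (s, y + 1) \<in> P" "\<And>y. (s + 1, y) \<in> P \<longleftrightarrow> (s, y + 1) \<in> P"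
  shows "spread s (contract_pt s ` P) = P"
proof -
  have "(x, y) \<in> P" if "contract_pt s (x, y) = contract_pt s (x', y')" "(x', y') \<in> P" for x y x' y'
  proof -
    have "(x, y) = (x', y') \<or> x \<in> {s - 1, s, s + 1} \<and> x' \<in> {s - 1, s, s + 1}"
      using that(1) by (auto simp: contract_pt_def split: if_splits)
    then show ?thesis
      using that assms[of y] assms[of y'] assms[of "y - 1"] assms[of "y' - 1"]
      by (auto simp: contract_pt_def split: if_splits)
  qed
  then show ?thesis unfolding spread_eq_vimage by auto
qed

lemma spread_contract_fun:
  assumes "h (s - 1) = h s - 1" "h (s + 1) = h s - 1"
  shows "spread_fun s (contract_fun s h) = h"
proof
  show "spread_fun s (contract_fun s h) x = h x" for x
    using assms by (cases "x = s + 1") (auto simp: spread_fun_def contract_fun_def)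
qed

lemma spread_graph_on:
  assumes "a \<le> s" "s \<le> b"
  shows "spread s (graph_on a b h) = graph_on (a - 1) (b + 1) (spread_fun s h)"
  using assms by (auto simp: mem_spread spread_fun_def split: if_splits)

lemma spread_tiling_of:
  assumes "- int n \<le> s" "s \<le> int n"
  shows "spread_tiling s (tiling_of n l m X) =
    tiling_of (Suc n) (spread_fun s l) (spread_fun s m) (spread s ` X)"
proof -
  have "- int (Suc n) = - int n - 1" "int (Suc n) = int n + 1" by simp_all
  then show ?thesis
    using assms by (simp only: tiling_of_def spread_tiling_def spread_graph_on tiling.sel)
qed

text \<open>Spreading inserts an up step and a down step around column \<open>s\<close>. The step of
  \<open>h\<close> leaving \<open>x\<close> survives one column further left if
  \<open>x < s\<close>, and one column further right otherwise.\<close>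

lemma unit_steps_spread_fun:
  assumes "a \<le> s" "s \<le> b"
  shows "unit_steps (a - 1) (b + 1) (spread_fun s h) \<longleftrightarrow> unit_steps a b h"
proof
  assume "unit_steps a b h"
  then show "unit_steps (a - 1) (b + 1) (spread_fun s h)"
    using assms unfolding unit_steps_def spread_fun_def
    by (smt (verit))
next
  assume L: "unit_steps (a - 1) (b + 1) (spread_fun s h)"
  show "unit_steps a b h"
    unfolding unit_steps_def
  proof (intro allI impI)
    fix x assume x: "a \<le> x \<and> x < b"
    show "h (x + 1) = h x + 1 \<or> h (x + 1) = h x - 1"
    proof (cases "x < s")
      case True
      then show ?thesis
        using L[unfolded unit_steps_def spread_fun_def, rule_format, of "x - 1"] x assms by auto
    next
      case False
      then show ?thesis
        using L[unfolded unit_steps_def spread_fun_def, rule_format, of "x + 1"] x assms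
        by (auto simp: add.commute[of 1])
    qed
  qed
qed

lemma le_spread_fun:
  assumes "a \<le> s" "s \<le> b"
  shows "(\<forall>x. a - 1 \<le> x \<and> x \<le> b + 1 \<longrightarrow> spread_fun s g x \<le> spread_fun s h x) \<longleftrightarrow>
    (\<forall>x. a \<le> x \<and> x \<le> b \<longrightarrow> g x \<le> h x)" (is "?L \<longleftrightarrow> ?R")
proof
  assume ?R then show ?L using assms by (auto simp: spread_fun_def)
next
  assume L: ?L
  show ?R
  proof (intro allI impI)
    fix x assume "a \<le> x \<and> x \<le> b"
    then show "g x \<le> h x"
      using L[rule_format, of "x - 1"] L[rule_format, of "x + 1"] assms
      by (cases "x \<le> s") (auto simp: spread_fun_def split: if_splits)
  qed
qed

lemma dyck_fun_spread:
  assumes "- int n \<le> s" "s \<le> int n"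
  shows "dyck_fun (Suc n) (spread_fun s h) \<longleftrightarrow> dyck_fun n h"
proof -
  have e: "int (Suc n) = int n + 1" "- (int n + 1) = - int n - 1" by auto
  have ends: "spread_fun s h (- int n - 1) = h (- int n)" "spread_fun s h (int n + 1) = h (int n)"
    using assms by (auto simp: spread_fun_def)
  have "(\<forall>x. - int n - 1 \<le> x \<and> x \<le> int n + 1 \<longrightarrow> 0 \<le> spread_fun s h x) \<longleftrightarrow>
      (\<forall>x. - int n \<le> x \<and> x \<le> int n \<longrightarrow> 0 \<le> h x)" (is "?L \<longleftrightarrow> ?R")
  proof
    assume ?R then show ?L using assms by (auto simp: spread_fun_def)
  next
    assume L: ?L
    show ?R
    proof (intro allI impI)
      fix x assume "- int n \<le> x \<and> x \<le> int n"
      then show "0 \<le> h x"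
        using L[rule_format, of "x - 1"] L[rule_format, of "x + 1"] assms
        by (cases "x \<le> s") (auto simp: spread_fun_def split: if_splits)
    qed
  qed
  then show ?thesis
    unfolding dyck_fun_def e unit_steps_spread_fun[OF assms] ends by simp
qed

lemma region_spread:
  assumes "- int n \<le> s" "s \<le> int n"
  shows "region (Suc n) (spread_fun s l) (spread_fun s m) = spread s (region n l m)"
  using assms by (auto simp: mem_spread spread_fun_def region_def split: if_splits)

text \<open>Preimages commute with unions and intersections, and under a surjection distinct sets
  have distinct preimages. Hence each clause of \<open>partition_on\<close> is reflected as well as
  preserved.\<close>

lemma partition_on_vimage:
  assumes "surj f"
  shows "partition_on (f -` A) ((-`) f ` P) \<longleftrightarrow> partition_on A P"
proof -
  have inj: "f -` a = f -` b \<longleftrightarrow> a = b" for a b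
    using assms by (metis surj_image_vimage_eq)
  have "\<Union>((-`) f ` P) = f -` A \<longleftrightarrow> \<Union>P = A"
    using inj[of "\<Union>P" A] by (simp add: vimage_Union)
  moreover have "f -` a \<inter> f -` b = {} \<longleftrightarrow> a \<inter> b = {}" for a b
    using inj[of "a \<inter> b" "{}"] by (simp only: vimage_Int vimage_empty)
  then have "disjoint ((-`) f ` P) \<longleftrightarrow> disjoint P"
    by (auto simp: disjoint_def inj)
  moreover have "{} \<in> (-`) f ` P \<longleftrightarrow> {} \<in> P"
    using inj[of "{}"] by (simp add: image_iff Bex_def)
  ultimately show ?thesis by (simp add: partition_on_def)
qed

text \<open>A tile away from column \<open>s\<close> is translated, and a tile through column
  \<open>s\<close> acquires a peak there. Conversely, a spread set that is a tile either misses the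
  columns \<open>s - 1\<close>, \<open>s\<close>, \<open>s + 1\<close> or crosses all three with a
  peak at \<open>s\<close>.\<close>

lemma dyck_tile_spread: "dyck_tile (spread s t) \<longleftrightarrow> dyck_tile t"
proof
  assume "dyck_tile t"
  then obtain a b h where h: "a \<le> b" "t = graph_on a b h" "unit_steps a b h" "h a = h b"
      "\<And>x. a \<le> x \<Longrightarrow> x \<le> b \<Longrightarrow> h a \<le> h x"
    unfolding dyck_tile_iff by blast
  consider "s < a" | "b < s" | "a \<le> s" "s \<le> b" by linarith
  then show "dyck_tile (spread s t)"
  proof cases
    case 1
    have "spread s t = graph_on (a + 1) (b + 1) (\<lambda>x. h (x - 1))"
      using 1 h(1) unfolding h(2) by (auto simp: mem_spread split: if_splits)
    moreover have "unit_steps (a + 1) (b + 1) (\<lambda>x. h (x - 1))"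
      using h(3) by (auto simp: unit_steps_def) (smt (verit))
    ultimately show ?thesis using h by (simp add: dyck_tile_graph_on)
  next
    case 2
    have "spread s t = graph_on (a - 1) (b - 1) (\<lambda>x. h (x + 1))"
      using 2 h(1) unfolding h(2) by (auto simp: mem_spread split: if_splits)
    moreover have "unit_steps (a - 1) (b - 1) (\<lambda>x. h (x + 1))"
      using h(3) unfolding unit_steps_def by (smt (verit))
    ultimately show ?thesis using h by (simp add: dyck_tile_graph_on)
  next
    case 3
    \<comment> \<open>The only new height is that of the inserted peak, which therefore stays above
      the base level of the tile.\<close>
    have "h a \<le> h s + 1" using h(5)[OF 3] by simp
    then show ?thesis
      unfolding h(2) spread_graph_on[OF 3]
      using 3 h unit_steps_spread_fun[OF 3, of h]
      by (intro dyck_tile_graph_on) (auto simp: spread_fun_def)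
  qed
next
  assume "dyck_tile (spread s t)"
  then obtain a b h where h: "a \<le> b" "spread s t = graph_on a b h" "unit_steps a b h" "h a = h b"
      "\<And>x. a \<le> x \<Longrightarrow> x \<le> b \<Longrightarrow> h a \<le> h x"
    unfolding dyck_tile_iff by blast
  have t: "(x, y) \<in> t \<longleftrightarrow> (if x \<le> s then (x - 1, y) \<in> spread s t else (x + 1, y) \<in> spread s t)" for x y
    by (auto simp: mem_spread)
  have l: "(s - 1, y) \<in> graph_on a b h \<longleftrightarrow> (s, y + 1) \<in> graph_on a b h"
    and r: "(s + 1, y) \<in> graph_on a b h \<longleftrightarrow> (s, y + 1) \<in> graph_on a b h" for y
    unfolding h(2)[symmetric] by (simp_all add: mem_spread)
  \<comment> \<open>By \<open>l\<close> and \<open>r\<close>, occupying one of the three columns at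
    a suitable height forces the other two.\<close>
  consider "s + 1 < a" | "b < s - 1" | "a \<le> s - 1" "s + 1 \<le> b" "h (s - 1) = h s - 1" "h (s + 1) = h s - 1"
  proof (cases "a \<le> s \<and> s \<le> b")
    case True
    then show ?thesis using l[of "h s - 1"] r[of "h s - 1"] by (intro that(3)) auto
  next
    case False
    then have "\<not> (a \<le> s - 1 \<and> s - 1 \<le> b)" "\<not> (a \<le> s + 1 \<and> s + 1 \<le> b)"
      using l[of "h (s - 1)"] r[of "h (s + 1)"] by auto
    then show ?thesis using False \<open>a \<le> b\<close> that(1,2) by linarith
  qed
  then show "dyck_tile t"
  proof cases
    case 1
    have "t = graph_on (a - 1) (b - 1) (\<lambda>x. h (x + 1))"
      using 1 h(1) t unfolding h(2) by (auto split: if_splits)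
    moreover have "unit_steps (a - 1) (b - 1) (\<lambda>x. h (x + 1))"
      using h(3) unfolding unit_steps_def by (smt (verit))
    ultimately show ?thesis using h by (simp add: dyck_tile_graph_on)
  next
    case 2
    have "t = graph_on (a + 1) (b + 1) (\<lambda>x. h (x - 1))"
      using 2 h(1) t unfolding h(2) by (auto split: if_splits)
    moreover have "unit_steps (a + 1) (b + 1) (\<lambda>x. h (x - 1))"
      using h(3) by (auto simp: unit_steps_def) (smt (verit))
    ultimately show ?thesis using h by (simp add: dyck_tile_graph_on)
  next
    case 3
    let ?g = "contract_fun s h"
    have s: "a + 1 \<le> s" "s \<le> b - 1" using 3 by auto
    have g: "spread_fun s ?g = h" using 3 by (intro spread_contract_fun)
    have "spread s t = spread s (graph_on (a + 1) (b - 1) ?g)"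
      unfolding spread_graph_on[OF s] g h(2) by simp
    then have "t = graph_on (a + 1) (b - 1) ?g" by (simp add: spread_inject)
    moreover have "unit_steps (a + 1) (b - 1) ?g"
      using unit_steps_spread_fun[OF s, of ?g] h(3) by (simp add: g)
    moreover have "?g (a + 1) = h a"
      using 3(1) by (simp add: contract_fun_def)
    \<comment> \<open>If \<open>b = s + 1\<close>, the last column of the contracted tile is
      \<open>s\<close>, where \<open>?g\<close> takes the value \<open>h (s - 1)\<close>; the peak
      makes it equal to \<open>h b\<close>.\<close>
    moreover have "?g (b - 1) = h b"
    proof (cases "b = s + 1")
      case True
      then show ?thesis using 3 by (simp add: contract_fun_def)
    next
      case False
      then show ?thesis using 3(2) by (simp add: contract_fun_def)
    qed
    moreover have "h a \<le> ?g x" if "a + 1 \<le> x" "x \<le> b - 1" for x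
      using that h(5)[of "x - 1"] h(5)[of "x + 1"] by (simp add: contract_fun_def)
    ultimately show ?thesis
      using s h(4) by (intro dyck_tile_graph_on[of "a + 1" "b - 1" ?g, folded \<open>t = _\<close>]) auto
  qed
qed

text \<open>The two boxes of a covering pair share a column, so spreading moves both by the same
  vectors.\<close>

lemma covers_spread: "covers (spread s A) (spread s B) \<longleftrightarrow> covers A B"
proof
  assume "covers A B"
  then obtain x y where xy: "(x, y) \<in> B" "(x, y + 2) \<in> A" unfolding covers_def by blast
  show "covers (spread s A) (spread s B)"
  proof (cases "x \<le> s")
    case True
    then have "(x - 1, y) \<in> spread s B" "(x - 1, y + 2) \<in> spread s A" using xy by (auto simp: mem_spread)
    then show ?thesis unfolding covers_def by blast
  next
    case False
    then have "(x + 1, y) \<in> spread s B" "(x + 1, y + 2) \<in> spread s A" using xy by (auto simp: mem_spread)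
    then show ?thesis unfolding covers_def by blast
  qed
next
  assume "covers (spread s A) (spread s B)"
  then obtain x y where xy: "(x, y) \<in> spread s B" "(x, y + 2) \<in> spread s A"
    unfolding covers_def by blast
  have "y + 2 - 1 = y - 1 + 2" by simp
  then show "covers A B"
    using xy unfolding covers_def mem_spread by (metis (no_types))
qed

text \<open>The columns of a spread set are the preimage of the original columns under the collapse
  \<open>g\<close> of the integers; as \<open>g\<close> is onto, inclusions are reflected
  too.\<close>

lemma columns_spread: "fst ` spread s A \<subseteq> fst ` spread s B \<longleftrightarrow> fst ` A \<subseteq> fst ` B"
proof -
  define g :: "int \<Rightarrow> int" where "g x = (if x < s then x + 1 else if x = s then x else x - 1)" for x
  have "x \<in> fst ` spread s P \<longleftrightarrow> g x \<in> fst ` P" for x P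
  proof -
    have "(\<exists>y. (s, y - 1) \<in> P) \<longleftrightarrow> (\<exists>y. (s, y) \<in> P)" by (metis add_diff_cancel_right')
    then have "(\<exists>y. (x, y) \<in> spread s P) \<longleftrightarrow> (\<exists>y. (g x, y) \<in> P)"
      by (auto simp: mem_spread g_def)
    then show ?thesis by (force simp: image_iff)
  qed
  then have "fst ` spread s P = g -` (fst ` P)" for P by blast
  moreover have "surj g"
  proof (rule surjI)
    show "g (if x \<le> s then x - 1 else x + 1) = x" for x by (auto simp: g_def)
  qed
  ultimately show ?thesis
    by (metis surj_image_vimage_eq vimage_mono image_mono)
qed

text \<open>Read from right to left this serves growing, from left to right the contraction of a
  peaked tiling.\<close>

lemma ci_data_spread:
  assumes "- int n \<le> s" "s \<le> int n"
  shows "ci_data (Suc n) (spread_fun s l) (spread_fun s m) (spread s ` X) \<longleftrightarrow> ci_data n l m X"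
proof -
  have e: "int (Suc n) = int n + 1" "- (int n + 1) = - int n - 1" by auto
  have "partition_on (spread s (region n l m)) (spread s ` X) \<longleftrightarrow> partition_on (region n l m) X"
    using partition_on_vimage[OF surj_contract_pt[of s]] by (simp add: spread_eq_vimage[abs_def])
  moreover have "(\<forall>x. - int (Suc n) \<le> x \<and> x \<le> int (Suc n) \<longrightarrow> spread_fun s l x \<le> spread_fun s m x)
      \<longleftrightarrow> (\<forall>x. - int n \<le> x \<and> x \<le> int n \<longrightarrow> l x \<le> m x)"
    using le_spread_fun[OF assms, of l m] unfolding e .
  ultimately show ?thesis
    unfolding ci_data_def region_spread[OF assms] dyck_fun_spread[OF assms]
    by (auto simp: dyck_tile_spread covers_spread columns_spread)
qed

section \<open>Tilings with a peak at an eligible column\<close>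

text \<open>The intended description of the image of spreading at \<open>s\<close>. Eligibility
  supplies the up step into \<open>s\<close>, the last condition the down step out of it.\<close>

definition peaked_tilings :: "nat \<Rightarrow> int \<Rightarrow> tiling set" where
  "peaked_tilings n s = {U \<in> cover_inclusive_tilings n. eligible U s \<and>
     (\<exists>h. (s, h) \<in> upper U \<and> (s + 1, h - 1) \<in> upper U)}"

lemma eligible_tiling_of:
  "eligible (tiling_of n l m X) s \<longleftrightarrow>
     - int n < s \<and> s \<le> int n \<and> m s = m (s - 1) + 1 \<and> {(s, m s - 2)} \<notin> X"
  by (auto simp: eligible_def up_step_def)

lemma tiling_of_in_peaked_tilings:
  "tiling_of n l m X \<in> peaked_tilings n s \<longleftrightarrow>
     ci_data n l m X \<and> eligible (tiling_of n l m X) s \<and> s < int n \<and> m (s + 1) = m s - 1"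
  by (auto simp: peaked_tilings_def ci_tiling_of eligible_tiling_of)

lemma ci_dataD:
  assumes "ci_data n l m X"
  shows "dyck_fun n l" "dyck_fun n m" "\<And>x. - int n \<le> x \<Longrightarrow> x \<le> int n \<Longrightarrow> l x \<le> m x"
    "partition_on (region n l m) X" "\<And>t. t \<in> X \<Longrightarrow> dyck_tile t"
    "\<And>A B. A \<in> X \<Longrightarrow> B \<in> X \<Longrightarrow> covers A B \<Longrightarrow> fst ` A \<subseteq> fst ` B"
  using assms by (simp_all add: ci_data_def)

lemma partition_on_same_block:
  "partition_on A P \<Longrightarrow> t \<in> P \<Longrightarrow> u \<in> P \<Longrightarrow> x \<in> t \<Longrightarrow> x \<in> u \<Longrightarrow> t = u"
  by (auto simp: partition_on_def disjoint_def)

text \<open>Wherever the tile continues beyond column \<open>s\<close>, it steps down. Were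
  \<open>s\<close> one end of a longer tile, its neighbour would then lie below the base level, so
  \<open>s\<close> is an interior column.\<close>

lemma dyck_tile_peak:
  assumes "dyck_tile t" "(s, y) \<in> t" "(s - 1, y + 1) \<notin> t" "(s + 1, y + 1) \<notin> t" "t \<noteq> {(s, y)}"
  shows "(s - 1, y - 1) \<in> t" "(s + 1, y - 1) \<in> t"
proof -
  obtain a b h where h: "a \<le> b" "t = graph_on a b h" "unit_steps a b h" "h a = h b"
      "\<forall>x. a \<le> x \<and> x \<le> b \<longrightarrow> h a \<le> h x"
    using assms(1) unfolding dyck_tile_iff by blast
  have s: "a \<le> s" "s \<le> b" and y: "y = h s" using assms(2) h(2) by auto
  have down_left: "h (s - 1) = y - 1" if "a < s"
    using h(3)[unfolded unit_steps_def, rule_format, of "s - 1"] that s assms(3) by (auto simp: h(2) y)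
  have down_right: "h (s + 1) = y - 1" if "s < b"
    using h(3)[unfolded unit_steps_def, rule_format, of s] that s assms(4) by (auto simp: h(2) y)
  have "a < b"
  proof (rule ccontr)
    assume "\<not> a < b"
    then have "a = s" "b = s" using s by auto
    then have "t = {(s, y)}" unfolding h(2) graph_on_def y by auto
    then show False using assms(5) by simp
  qed
  have "a < s"
  proof (rule ccontr)
    assume "\<not> a < s"
    then have "a = s" using s by simp
    then show False using down_right h(5)[rule_format, of "s + 1"] \<open>a < b\<close> y by auto
  qed
  moreover have "s < b"
  proof (rule ccontr)
    assume "\<not> s < b"
    then have "b = s" using s by simp
    then show False using down_left h(5)[rule_format, of "s - 1"] h(4) \<open>a < b\<close> y by auto
  qed
  ultimately show "(s - 1, y - 1) \<in> t" "(s + 1, y - 1) \<in> t"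
    using down_left down_right s by (auto simp: h(2))
qed

lemma spread_in_peaked_tilings:
  assumes s: "- int n \<le> s" "s \<le> int n" and T: "T \<in> cover_inclusive_tilings n"
  shows "spread_tiling s T \<in> peaked_tilings (Suc n) s"
proof -
  obtain l m X where T: "T = tiling_of n l m X" "ci_data n l m X" using T by (rule ci_tilingE)
  \<comment> \<open>A spread tile with a box in column \<open>s\<close> also has one in column
    \<open>s - 1\<close>, so column \<open>s\<close> of the spread is eligible.\<close>
  have "{(s, y)} \<noteq> spread s t" for y t
  proof
    assume e: "{(s, y)} = spread s t"
    then have "(s - 1, y - 1) \<in> spread s t"
      using mem_spread[of s y s t] mem_spread[of "s - 1" "y - 1" s t] by auto
    then show False unfolding e[symmetric] by simp
  qed
  then show ?thesis
    using s T ci_data_spread[OF s] unfolding T(1) spread_tiling_of[OF s]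
    by (auto simp: tiling_of_in_peaked_tilings eligible_tiling_of spread_fun_def)
qed

text \<open>
  Eligibility forces the topmost tile in column \<open>s\<close> to run through columns \<open>s - 1\<close>, \<open>s\<close>, \<open>s + 1\<close>
  with a peak, and cover-inclusiveness passes this on to every tile below it.
\<close>

lemma peaked_tile:
  assumes U: "tiling_of n l m X \<in> peaked_tilings n s"
    and y: "(s, y) \<in> region n l m" and t: "t \<in> X" "(s, y) \<in> t"
  shows "(s - 1, y - 1) \<in> t \<and> (s + 1, y - 1) \<in> t"
proof -
  have ci: "ci_data n l m X" and s: "- int n < s" "s < int n"
    and m: "m (s - 1) = m s - 1" "m (s + 1) = m s - 1" and top: "{(s, m s - 2)} \<notin> X"
    using U by (auto simp: tiling_of_in_peaked_tilings eligible_tiling_of)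
  note ci = ci_dataD[OF ci]
  have sub: "t \<subseteq> region n l m" if "t \<in> X" for t
    using ci(4) that by (auto simp: partition_on_def)
  have "even (m s - l s)" using dyck_fun_parity[OF ci(1,2)] s by auto
  \<comment> \<open>The number of boxes above \<open>(s, y)\<close> in column \<open>s\<close>; the
    induction descends from the topmost box.\<close>
  define k where "k = nat ((m s - 2 - y) div 2)"
  have k: "y = m s - 2 - 2 * int k"
    using y \<open>even (m s - l s)\<close> unfolding k_def region_def by auto
  show ?thesis
    using y t k
  proof (induction k arbitrary: y t)
    case 0
    \<comment> \<open>Boxes at height \<open>y + 1\<close> beside the topmost box would stick out
      above the peak of the upper path.\<close>
    have "(s - 1, y + 1) \<notin> region n l m" "(s + 1, y + 1) \<notin> region n l m"
      using 0 m by (auto simp: region_def)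
    then show ?case
      using dyck_tile_peak[OF ci(5)[OF \<open>t \<in> X\<close>] \<open>(s, y) \<in> t\<close>] sub[OF \<open>t \<in> X\<close>] top 0 by auto
  next
    case (Suc k)
    have r: "(s, y + 2) \<in> region n l m"
      using Suc.prems(1,4) by (auto simp: region_def)
    then obtain u where u: "u \<in> X" "(s, y + 2) \<in> u"
      using ci(4) by (auto simp: partition_on_def)
    have up: "(s - 1, y + 1) \<in> u" "(s + 1, y + 1) \<in> u"
      using Suc.IH[OF r u] Suc.prems(4) by auto
    \<comment> \<open>The tile \<open>u\<close> extends to columns \<open>s - 1\<close> and
      \<open>s + 1\<close>; cover-inclusiveness makes \<open>t\<close> extend there as well, so
      \<open>t\<close> has more than one box.\<close>
    have "covers u t" unfolding covers_def using u Suc.prems(3) by blast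
    then have "fst ` u \<subseteq> fst ` t" by (rule ci(6)[OF u(1) Suc.prems(2)])
    then have "s + 1 \<in> fst ` t" using up by force
    then have "t \<noteq> {(s, y)}" by auto
    \<comment> \<open>A tile has only one box per column, whereas \<open>t\<close> and
      \<open>u\<close> contain different boxes of column \<open>s\<close>. Being distinct they are
      disjoint, so \<open>t\<close> cannot rise beside \<open>s\<close>.\<close>
    moreover have "t \<noteq> u"
    proof -
      obtain a b h where "u = graph_on a b h"
        using ci(5)[OF u(1)] unfolding dyck_tile_iff by blast
      then show ?thesis using u(2) Suc.prems(3) by auto
    qed
    then have "(s - 1, y + 1) \<notin> t" "(s + 1, y + 1) \<notin> t"
      using partition_on_same_block[OF ci(4) Suc.prems(2) u(1)] up by auto
    ultimately show ?case
      using dyck_tile_peak[OF ci(5)[OF \<open>t \<in> X\<close>] \<open>(s, y) \<in> t\<close>] by auto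
  qed
qed

text \<open>Once the lower path and all tiles are shown to be compatible with the collapse of the
  three columns, contracting them gives the required preimage.\<close>

lemma peaked_tilings_spread:
  assumes "U \<in> peaked_tilings (Suc n) s"
  shows "- int n \<le> s \<and> s \<le> int n \<and> (\<exists>T\<in>cover_inclusive_tilings n. U = spread_tiling s T)"
proof -
  obtain l m X where U: "U = tiling_of (Suc n) l m X"
    using assms ci_tilingE unfolding peaked_tilings_def by blast
  note pk = assms[unfolded U]
  have ci: "ci_data (Suc n) l m X" and s: "- int (Suc n) < s" "s < int (Suc n)"
    and m: "m (s - 1) = m s - 1" "m (s + 1) = m s - 1"
    using pk by (auto simp: tiling_of_in_peaked_tilings eligible_tiling_of)
  note ciD = ci_dataD[OF ci]
  have sn: "- int n \<le> s" "s \<le> int n" using s by auto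
  have par: "even (m s - l s)" using dyck_fun_parity[OF ciD(1,2)] s by auto
  have steps: "l (s + 1) = l s + 1 \<or> l (s + 1) = l s - 1" "l s = l (s - 1) + 1 \<or> l s = l (s - 1) - 1"
    using dyck_fun_step[OF ciD(1), of s] dyck_fun_step[OF ciD(1), of "s - 1"] s by auto
  have le: "l s \<le> m s" "l (s - 1) \<le> m (s - 1)" "l (s + 1) \<le> m (s + 1)"
    using ciD(3)[of s] ciD(3)[of "s - 1"] ciD(3)[of "s + 1"] s by auto
  \<comment> \<open>Where the paths meet, the peak of the upper path forces one on the lower path.
    Otherwise the lowest box in column \<open>s\<close> has neighbours in its tile one unit lower,
    and these must still lie above the lower path.\<close>
  have l: "l (s - 1) = l s - 1 \<and> l (s + 1) = l s - 1"
  proof (cases "l s = m s")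
    case True
    then show ?thesis using steps le m by auto
  next
    case False
    then have "l s + 2 \<le> m s" using le par by presburger
    then have r: "(s, l s) \<in> region (Suc n) l m" using s by (auto simp: region_def)
    then obtain t where t: "t \<in> X" "(s, l s) \<in> t" using ciD(4) by (auto simp: partition_on_def)
    have "t \<subseteq> region (Suc n) l m" using t(1) ciD(4) by (auto simp: partition_on_def)
    then have "(s - 1, l s - 1) \<in> region (Suc n) l m" "(s + 1, l s - 1) \<in> region (Suc n) l m"
      using peaked_tile[OF pk r t] by auto
    then have "l (s - 1) \<le> l s - 1" "l (s + 1) \<le> l s - 1" by (simp_all add: region_def)
    then show ?thesis using steps by linarith
  qed
  \<comment> \<open>For a box beside column \<open>s\<close>, the two peaks put the matching box of
    column \<open>s\<close> inside the shape; its tile contains the given box by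
    \<open>peaked_tile\<close>, so by disjointness it is \<open>t\<close>.\<close>
  have sat: "spread s (contract_pt s ` t) = t" if t: "t \<in> X" for t
  proof (rule spread_contract)
    have sub: "t \<subseteq> region (Suc n) l m" using t ciD(4) by (auto simp: partition_on_def)
    have up: "(s, y + 1) \<in> t" if xy: "(x, y) \<in> t" "x = s - 1 \<or> x = s + 1" for x y
    proof -
      have "(x, y) \<in> region (Suc n) l m" using sub xy by blast
      then have r: "(s, y + 1) \<in> region (Suc n) l m"
        using xy(2) l m s by (auto simp: region_def)
      then obtain u where u: "u \<in> X" "(s, y + 1) \<in> u" using ciD(4) by (auto simp: partition_on_def)
      then have "(x, y) \<in> u" using peaked_tile[OF pk r u] xy(2) by auto
      then have "t = u" using partition_on_same_block[OF ciD(4) t u(1) xy(1)] by simp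
      then show ?thesis using u by simp
    qed
    have down: "(s - 1, y) \<in> t \<and> (s + 1, y) \<in> t" if "(s, y + 1) \<in> t" for y
      using peaked_tile[OF pk _ t that] sub that by auto
    show "(s - 1, y) \<in> t \<longleftrightarrow> (s, y + 1) \<in> t" "(s + 1, y) \<in> t \<longleftrightarrow> (s, y + 1) \<in> t" for y
      using up down by blast+
  qed
  let ?l = "contract_fun s l" and ?m = "contract_fun s m" and ?X = "(`) (contract_pt s) ` X"
  have e: "spread_fun s ?l = l" "spread_fun s ?m = m" "spread s ` ?X = X"
    using l m sat by (simp_all add: spread_contract_fun image_image)
  have "ci_data n ?l ?m ?X"
    using ci_data_spread[OF sn, of ?l ?m ?X] ci by (simp add: e)
  moreover have "U = spread_tiling s (tiling_of n ?l ?m ?X)"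
    unfolding spread_tiling_of[OF sn] e U ..
  ultimately show ?thesis using sn ci_tiling_of by blast
qed

section \<open>Adding and removing one-box tiles\<close>

text \<open>In the converse direction, a block of \<open>X\<close> meeting \<open>B\<close> would
  coincide with one of the singletons, which the second hypothesis excludes.\<close>

lemma partition_on_singletons:
  assumes "B \<inter> S = {}" "X \<inter> (\<lambda>x. {x}) ` B = {}"
  shows "partition_on (S \<union> B) (X \<union> (\<lambda>x. {x}) ` B) \<longleftrightarrow> partition_on S X"
proof
  assume P: "partition_on S X"
  have "disjoint ((\<lambda>x. {x}) ` B)" by (auto simp: disjoint_def)
  then have "disjoint (X \<union> (\<lambda>x. {x}) ` B)"
    using P assms(1) by (intro disjoint_union) (auto simp: partition_on_def)
  then show "partition_on (S \<union> B) (X \<union> (\<lambda>x. {x}) ` B)"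
    using P by (auto simp: partition_on_def)
next
  assume P: "partition_on (S \<union> B) (X \<union> (\<lambda>x. {x}) ` B)"
  have "t \<inter> B = {}" if "t \<in> X" for t
  proof (rule ccontr)
    assume "t \<inter> B \<noteq> {}"
    then obtain x where "x \<in> t" "x \<in> B" by blast
    then have "t = {x}" using partition_on_same_block[OF P, of t "{x}" x] that by blast
    then show False using that \<open>x \<in> B\<close> assms(2) by blast
  qed
  moreover have "\<Union>X \<union> B = S \<union> B" using P by (auto simp: partition_on_def)
  ultimately have "\<Union>X = S" using assms(1) by blast
  then show "partition_on S X" using P by (auto simp: partition_on_def disjoint_def)
qed

definition raise_fun :: "int set \<Rightarrow> (int \<Rightarrow> int) \<Rightarrow> int \<Rightarrow> int" where
  "raise_fun K m x = (if x \<in> K then m x + 2 else m x)"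

definition columns_on :: "int set \<Rightarrow> (int \<Rightarrow> int) \<Rightarrow> point set" where
  "columns_on K m = (\<lambda>x. (x, m x)) ` K"

lemma mem_columns_on [simp]: "(x, y) \<in> columns_on K m \<longleftrightarrow> x \<in> K \<and> y = m x"
  by (auto simp: columns_on_def)

lemma add_boxes_tiling_of:
  assumes "K \<subseteq> {- int n..int n}"
  shows "add_boxes (columns_on K m) (tiling_of n l m X) =
    tiling_of n l (raise_fun K m) (X \<union> (\<lambda>c. {c}) ` columns_on K m)"
proof -
  have "graph_on (- int n) (int n) m - columns_on K m \<union> {(x, y + 2) |x y. (x, y) \<in> columns_on K m} =
      graph_on (- int n) (int n) (raise_fun K m)"
    using assms by (auto simp: raise_fun_def split: if_splits)
  moreover have "{{c} |c. c \<in> columns_on K m} = (\<lambda>c. {c}) ` columns_on K m" by blast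
  ultimately show ?thesis
    by (simp only: add_boxes_def tiling_of_def tiling.sel)
qed

text \<open>By parity, raising the upper path by 2 admits exactly one more box in that column, with
  lower corner on the old path.\<close>

lemma region_raise_fun:
  assumes "dyck_fun n l" "dyck_fun n m" "K \<subseteq> {- int n..int n}"
    and le: "\<And>x. - int n \<le> x \<Longrightarrow> x \<le> int n \<Longrightarrow> l x \<le> m x"
  shows "region n l (raise_fun K m) = region n l m \<union> columns_on K m"
proof -
  have "(x, y) \<in> region n l (raise_fun K m) \<longleftrightarrow> (x, y) \<in> region n l m \<or> x \<in> K \<and> y = m x" for x y
  proof (cases "x \<in> K")
    case True
    then have "- int n \<le> x" "x \<le> int n" using assms(3) by auto
    moreover have "even (m x - l x)" "l x \<le> m x"
      using dyck_fun_parity[OF assms(1,2)] le \<open>- int n \<le> x\<close> \<open>x \<le> int n\<close> by auto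
    then have "l x \<le> y \<and> y \<le> m x \<and> even (y - l x) \<longleftrightarrow>
        l x \<le> y \<and> y + 2 \<le> m x \<and> even (y - l x) \<or> y = m x" by presburger
    ultimately show ?thesis using True by (auto simp: region_def raise_fun_def)
  qed (auto simp: region_def raise_fun_def)
  then show ?thesis by auto
qed

lemma dyck_tile_singleton: "dyck_tile {c}"
proof -
  have "{c} = graph_on (fst c) (fst c) (\<lambda>_. snd c)" by (cases c) (auto simp: graph_on_def)
  then show ?thesis using dyck_tile_graph_on[of "fst c" "fst c" "\<lambda>_. snd c"] by (simp add: unit_steps_def)
qed

text \<open>An added box has its top corner on the new upper path, so nothing covers it; where it
  covers a tile, its single column trivially belongs to that tile. The equivalence serves both
  adding and removing boxes.\<close>

lemma ci_data_raise:
  assumes m: "dyck_fun n m" and m': "dyck_fun n (raise_fun K m)" and K: "K \<subseteq> {- int n..int n}"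
    and le: "\<And>x. - int n \<le> x \<Longrightarrow> x \<le> int n \<Longrightarrow> l x \<le> m x"
    and X: "X \<inter> (\<lambda>c. {c}) ` columns_on K m = {}"
  shows "ci_data n l (raise_fun K m) (X \<union> (\<lambda>c. {c}) ` columns_on K m) \<longleftrightarrow> ci_data n l m X"
    (is "ci_data n l ?m ?X \<longleftrightarrow> _")
proof (cases "dyck_fun n l")
  case True
  have le': "\<forall>x. - int n \<le> x \<and> x \<le> int n \<longrightarrow> l x \<le> ?m x"
    using le by (simp add: raise_fun_def add_increasing2)
  have reg: "region n l ?m = region n l m \<union> columns_on K m"
    by (rule region_raise_fun[OF True m K le])
  have "columns_on K m \<inter> region n l m = {}" by (auto simp: region_def)
  note part = partition_on_singletons[OF this X]
  have cov: "\<forall>A\<in>?X. \<forall>B\<in>?X. covers A B \<longrightarrow> fst ` A \<subseteq> fst ` B"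
    if P: "partition_on (region n l m) X" and c: "\<forall>A\<in>X. \<forall>B\<in>X. covers A B \<longrightarrow> fst ` A \<subseteq> fst ` B"
  proof (intro ballI impI)
    fix A B assume A: "A \<in> ?X" and B: "B \<in> ?X" and "covers A B"
    then obtain x y where xy: "(x, y) \<in> B" "(x, y + 2) \<in> A" unfolding covers_def by blast
    have "(x, y + 2) \<in> region n l ?m"
      using A P xy(2) unfolding reg partition_on_def by auto
    \<comment> \<open>A box directly above an added one would exceed the raised upper path.\<close>
    then have "(x, y) \<notin> columns_on K m" by (auto simp: region_def raise_fun_def)
    then have "B \<in> X" using B xy(1) by auto
    show "fst ` A \<subseteq> fst ` B"
    proof (cases "A \<in> X")
      case True
      then show ?thesis using c \<open>B \<in> X\<close> \<open>covers A B\<close> by blast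
    next
      case False
      then have "A = {(x, y + 2)}" using A xy(2) by auto
      then show ?thesis using xy(1) by force
    qed
  qed
  have tile: "(\<forall>t\<in>?X. dyck_tile t) \<longleftrightarrow> (\<forall>t\<in>X. dyck_tile t)"
    using dyck_tile_singleton by blast
  have "\<forall>x. - int n \<le> x \<and> x \<le> int n \<longrightarrow> l x \<le> m x" using le by blast
  then show ?thesis
    unfolding ci_data_def reg part tile using True m m' le' cov by blast
qed (simp add: ci_data_def)

lemma add_columns:
  assumes ci: "ci_data n l m X" and K: "K \<subseteq> {- int n..int n}" and m': "dyck_fun n (raise_fun K m)"
  shows "ci_data n l (raise_fun K m) (X \<union> (\<lambda>c. {c}) ` columns_on K m)"
proof -
  note ciD = ci_dataD[OF ci]
  have "{c} \<notin> X" if "c \<in> columns_on K m" for c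
  proof
    assume "{c} \<in> X"
    then have "c \<in> region n l m" using ciD(4) by (auto simp: partition_on_def)
    then show False using that by (auto simp: region_def columns_on_def)
  qed
  then show ?thesis using ci_data_raise[OF ciD(2) m' K ciD(3)] ci by blast
qed

lemma remove_columns:
  assumes ci: "ci_data n l m' X'" and m: "dyck_fun n m" and m': "m' = raise_fun K m"
    and K: "\<And>x. x \<in> K \<Longrightarrow> {(x, m x)} \<in> X'"
  obtains X where "ci_data n l m X" "X = X' - (\<lambda>c. {c}) ` columns_on K m"
    "tiling_of n l m' X' = add_boxes (columns_on K m) (tiling_of n l m X)"
proof -
  note ciD = ci_dataD[OF ci]
  have r: "(x, m x) \<in> region n l m'" if "x \<in> K" for x
    using ciD(4) K[OF that] by (auto simp: partition_on_def)
  then have K': "K \<subseteq> {- int n..int n}" by (auto simp: region_def)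
  \<comment> \<open>In a lowered column the removed box itself lies above the lower path, and its
    lower corner is the new upper height.\<close>
  have le: "l x \<le> m x" if "- int n \<le> x" "x \<le> int n" for x
    using r[of x] ciD(3)[OF that] by (cases "x \<in> K") (auto simp: region_def m' raise_fun_def)
  define X where "X = X' - (\<lambda>c. {c}) ` columns_on K m"
  have X': "X' = X \<union> (\<lambda>c. {c}) ` columns_on K m"
    using K by (auto simp: X_def columns_on_def)
  have "X \<inter> (\<lambda>c. {c}) ` columns_on K m = {}" by (auto simp: X_def)
  from ci_data_raise[OF m _ K' le this] ciD(2) ci have "ci_data n l m X"
    unfolding m' X'[symmetric] by blast
  moreover have "tiling_of n l m' X' = add_boxes (columns_on K m) (tiling_of n l m X)"
    unfolding add_boxes_tiling_of[OF K'] m' X'[symmetric] ..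
  ultimately show thesis using that X_def by blast
qed

text \<open>Given \<open>B\<close>, adding the boxes can be undone: their top corners do not lie on
  the old upper path, and boxes starting on that path were not tiles before.\<close>

lemma add_boxes_inject:
  assumes "U \<in> cover_inclusive_tilings n" "U' \<in> cover_inclusive_tilings n'"
    and "B \<subseteq> upper U" "B \<subseteq> upper U'" and "add_boxes B U = add_boxes B U'"
  shows "U = U'"
proof -
  let ?up = "{(x, y + 2) |x y. (x, y) \<in> B}" and ?R = "\<lambda>U. add_boxes B U"
  have "U = Tiling (lower (?R U)) (upper (?R U) - ?up \<union> B) (tiles (?R U) - {{c} |c. c \<in> B})"
    if U: "U \<in> cover_inclusive_tilings n" "B \<subseteq> upper U" for U n
  proof -
    obtain l m X where U': "U = tiling_of n l m X" "ci_data n l m X" using U(1) by (rule ci_tilingE)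
    have up: "upper U \<inter> ?up = {}" using U(2) by (auto simp: U')
    have "{c} \<notin> X" if "c \<in> B" for c
    proof
      assume "{c} \<in> X"
      then have "c \<in> region n l m" using ci_dataD(4)[OF U'(2)] by (auto simp: partition_on_def)
      moreover have "c \<in> graph_on (- int n) (int n) m" using U(2) that by (auto simp: U')
      ultimately show False by (cases c) (auto simp: region_def)
    qed
    then have "X \<inter> {{c} |c. c \<in> B} = {}" by blast
    then have "tiles U = (tiles U \<union> {{c} |c. c \<in> B}) - {{c} |c. c \<in> B}" by (auto simp: U')
    moreover have "upper U = (upper U - B \<union> ?up) - ?up \<union> B" using up U(2) by blast
    ultimately show ?thesis by (intro tiling.expand) (simp add: add_boxes_def)
  qed
  from this[OF assms(1,3)] this[OF assms(2,4)] assms(5) show ?thesis by simp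
qed

lemma special_columnI:
  assumes "eligible (tiling_of n l m X) s" "\<And>c. s < c \<Longrightarrow> \<not> eligible (tiling_of n l m X) c"
  shows "special_column (tiling_of n l m X) = s"
  unfolding special_column_def
proof (rule Max_eqI)
  show "finite {s. eligible (tiling_of n l m X) s}"
    by (rule finite_subset[of _ "{- int n..int n}"]) (auto simp: eligible_tiling_of)
qed (use assms not_le in auto)

text \<open>The witness \<open>s0\<close> makes the finite set of eligible columns nonempty, so its
  maximum is attained.\<close>

lemma special_columnD:
  assumes "eligible (tiling_of n l m X) s0" and s: "s = special_column (tiling_of n l m X)"
  shows "eligible (tiling_of n l m X) s" "s < c \<Longrightarrow> \<not> eligible (tiling_of n l m X) c" "s0 \<le> s"
proof -
  let ?E = "{s. eligible (tiling_of n l m X) s}"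
  have fin: "finite ?E"
    by (rule finite_subset[of _ "{- int n..int n}"]) (auto simp: eligible_tiling_of)
  show "eligible (tiling_of n l m X) s" "s0 \<le> s"
    using Max_in[OF fin] Max_ge[OF fin] assms unfolding special_column_def by auto
  show "\<not> eligible (tiling_of n l m X) c" if "s < c"
    using Max_ge[OF fin, of c] that unfolding s special_column_def by auto
qed

text \<open>The box below the end of the first step would lie below the horizontal axis.\<close>

lemma eligible_first_column:
  assumes ci: "ci_data (Suc n) l m X"
  shows "eligible (tiling_of (Suc n) l m X) (- int n)"
proof -
  note ciD = ci_dataD[OF ci]
  have e: "- int (Suc n) = - int n - 1" by simp
  have "0 \<le> m (- int n)" using ciD(2) by (simp add: dyck_fun_def)
  then have "m (- int n) \<noteq> - 1" by simp
  then have "m (- int n) = 1" "m (- int n - 1) = 0"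
    using dyck_fun_step[OF ciD(2), of "- int n - 1"] ciD(2)[unfolded dyck_fun_def e] by auto
  moreover have "0 \<le> l (- int n)" using ciD(1) by (auto simp: dyck_fun_def)
  then have "(- int n, -1) \<notin> region (Suc n) l m" by (auto simp: region_def)
  then have "{(- int n, -1)} \<notin> X" using ciD(4) by (auto simp: partition_on_def)
  ultimately show ?thesis by (simp add: eligible_tiling_of)
qed

section \<open>The grow maps\<close>

text \<open>The argument common to both grow maps: \<open>B\<close> chooses the boxes to add to the
  spread and \<open>C\<close> reads them off the result. From a result one recovers \<open>s\<close>
  as special column, then the boxes, then the spread, and finally the tiling.\<close>

lemma bij_betw_grow:
  assumes g: "\<And>T s. g T s = add_boxes (B s (spread_tiling s T)) (spread_tiling s T)"
    and fwd: "\<And>U s. U \<in> peaked_tilings (Suc n) s \<Longrightarrow> B s U \<subseteq> upper U \<and>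
      add_boxes (B s U) U \<in> cover_inclusive_tilings (Suc n) \<and>
      special_column (add_boxes (B s U) U) = s \<and> C s (add_boxes (B s U) U) = B s U"
    and bwd: "\<And>R s. R \<in> cover_inclusive_tilings (Suc n) \<Longrightarrow> s = special_column R \<Longrightarrow>
      \<exists>U\<in>peaked_tilings (Suc n) s. R = add_boxes (B s U) U"
  shows "bij_betw (\<lambda>(T, s). g T s) (cover_inclusive_tilings n \<times> {- int n..int n})
    (cover_inclusive_tilings (Suc n))"
proof -
  have pk: "spread_tiling s T \<in> peaked_tilings (Suc n) s"
    if "T \<in> cover_inclusive_tilings n" "s \<in> {- int n..int n}" for T s
    using spread_in_peaked_tilings that by simp
  have "inj_on (\<lambda>(T, s). g T s) (cover_inclusive_tilings n \<times> {- int n..int n})"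
  proof (intro inj_onI, clarify)
    fix T s T' s'
    assume T: "T \<in> cover_inclusive_tilings n" "s \<in> {- int n..int n}"
      and T': "T' \<in> cover_inclusive_tilings n" "s' \<in> {- int n..int n}" and eq: "g T s = g T' s'"
    note pk = pk[OF T] pk[OF T']
    note f = fwd[OF pk(1)] fwd[OF pk(2)]
    have "s = s'" using f eq unfolding g by simp
    then have "B s (spread_tiling s T) = B s (spread_tiling s T')" using f eq unfolding g by simp
    then have "spread_tiling s T = spread_tiling s T'"
      using add_boxes_inject[of "spread_tiling s T" "Suc n" "spread_tiling s T'" "Suc n"]
        pk f eq \<open>s = s'\<close> unfolding g by (auto simp: peaked_tilings_def)
    then show "T = T' \<and> s = s'" using \<open>s = s'\<close> by (simp add: spread_tiling_inject)
  qed
  moreover have "R \<in> (\<lambda>(T, s). g T s) ` (cover_inclusive_tilings n \<times> {- int n..int n})"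
    if R: "R \<in> cover_inclusive_tilings (Suc n)" for R
  proof -
    obtain s U where U: "U \<in> peaked_tilings (Suc n) s" "R = add_boxes (B s U) U"
      using bwd[OF R] by blast
    then obtain T where "T \<in> cover_inclusive_tilings n" "U = spread_tiling s T" "s \<in> {- int n..int n}"
      using peaked_tilings_spread[OF U(1)] by auto
    then show ?thesis using U(2) g by (intro image_eqI[of _ _ "(T, s)"]) auto
  qed
  moreover have "g T s \<in> cover_inclusive_tilings (Suc n)"
    if "T \<in> cover_inclusive_tilings n" "s \<in> {- int n..int n}" for T s
    using fwd[OF pk[OF that]] g by simp
  ultimately show ?thesis by (auto simp: bij_betw_def)
qed

lemma dyck_funI:
  assumes "\<And>x. - int n \<le> x \<Longrightarrow> x < int n \<Longrightarrow> h (x + 1) = h x + 1 \<or> h (x + 1) = h x - 1"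
    and "h (- int n) = 0" "h (int n) = 0" "\<And>x. - int n \<le> x \<Longrightarrow> x \<le> int n \<Longrightarrow> 0 \<le> h x"
  shows "dyck_fun n h"
  using assms by (simp add: dyck_fun_def unit_steps_def)

lemma peaked_tilingsE:
  assumes "U \<in> peaked_tilings n s"
  obtains l m X where "U = tiling_of n l m X" "ci_data n l m X" "- int n < s" "s < int n"
    "m (s - 1) = m s - 1" "m (s + 1) = m s - 1" "{(s, m s - 2)} \<notin> X" "eligible U s"
proof -
  obtain l m X where U: "U = tiling_of n l m X"
    using assms ci_tilingE unfolding peaked_tilings_def by blast
  show thesis
    using assms unfolding U tiling_of_in_peaked_tilings
    by (intro that[OF U]) (auto simp: eligible_tiling_of U)
qed

lemma ci_tiling_specialE:
  assumes "R \<in> cover_inclusive_tilings (Suc n)" "s = special_column R"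
  obtains l m X where "R = tiling_of (Suc n) l m X" "ci_data (Suc n) l m X"
    "eligible (tiling_of (Suc n) l m X) s" "s < int (Suc n)"
    "\<And>c. s < c \<Longrightarrow> c \<le> int (Suc n) \<Longrightarrow> m c = m (c - 1) + 1 \<Longrightarrow> {(c, m c - 2)} \<in> X"
proof -
  let ?N = "Suc n"
  obtain l m X where R: "R = tiling_of ?N l m X" "ci_data ?N l m X"
    using assms(1) by (rule ci_tilingE)
  note sp = special_columnD[OF eligible_first_column[OF R(2)] assms(2)[unfolded R]]
  have s: "- int ?N < s" "s \<le> int ?N" "m s = m (s - 1) + 1"
    using sp(1) by (auto simp: eligible_tiling_of)
  \<comment> \<open>An up step into the last column would start at height -1, so the special column
    lies strictly before it.\<close>
  have "0 \<le> m (s - 1)" "m (int ?N) = 0"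
    using ci_dataD(2)[OF R(2)] s unfolding dyck_fun_def by auto
  then have "s \<noteq> int ?N" using s(3) by auto
  then show thesis
    using that[OF R sp(1)] sp(2) s by (auto simp: eligible_tiling_of)
qed

lemma mem_columns_singletons [simp]:
  "{(x, y)} \<in> (\<lambda>c. {c}) ` columns_on K m \<longleftrightarrow> x \<in> K \<and> y = m x"
  by (auto simp: columns_on_def)

lemma dyck_fun_ends:
  assumes "dyck_fun n m"
  shows "m (- int n) = 0" "m (int n) = 0" "- int n \<le> x \<Longrightarrow> x \<le> int n \<Longrightarrow> 0 \<le> m x"
  using assms by (simp_all add: dyck_fun_def)

section \<open>Boxes added on the up steps to the right of \<open>s\<close>\<close>

definition sgrow_boxes :: "int \<Rightarrow> tiling \<Rightarrow> point set" where
  "sgrow_boxes s U = {(a, h) | a h. up_step (upper U) a h \<and> s \<le> a}"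

text \<open>The point \<open>(x, y + 2)\<close>, where the up step ends, is the top corner of the
  box with lower corner \<open>(x, y)\<close>.\<close>

definition sgrow_boxes_of_result :: "int \<Rightarrow> tiling \<Rightarrow> point set" where
  "sgrow_boxes_of_result s R = {(x, y). s < x \<and> up_step (upper R) (x - 1) (y + 1)}"

text \<open>From column \<open>s\<close> up to the last column but one, adding the boxes moves the
  upper path one unit left and one unit up; this is the fact \<open>right\<close>. Every up step of
  the result right of \<open>s\<close> therefore ends on top of an added box.\<close>

lemma sgrow_peaked:
  assumes U: "U \<in> peaked_tilings n s" and R: "R = add_boxes (sgrow_boxes s U) U"
  shows "sgrow_boxes s U \<subseteq> upper U" "R \<in> cover_inclusive_tilings n" "special_column R = s"
    "sgrow_boxes_of_result s R = sgrow_boxes s U"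
proof -
  let ?N = "int n"
  obtain l m X where U: "U = tiling_of n l m X" and ci: "ci_data n l m X" and s: "- ?N < s" "s < ?N"
    and m: "m (s - 1) = m s - 1" "m (s + 1) = m s - 1" and top: "{(s, m s - 2)} \<notin> X"
    using U by (rule peaked_tilingsE)
  note ciD = ci_dataD[OF ci]
  note step = dyck_fun_step[OF ciD(2)]
  note ends = dyck_fun_ends[OF ciD(2)]
  define K where "K = {x. s \<le> x \<and> x < ?N \<and> m (x + 1) = m x + 1}"
  define m' where "m' = raise_fun K m"
  have K: "K \<subseteq> {- ?N..?N}" using s by (auto simp: K_def)
  have boxes: "sgrow_boxes s U = columns_on K m"
    using s by (auto simp: sgrow_boxes_def U up_step_def K_def)
  then show "sgrow_boxes s U \<subseteq> upper U" using K by (auto simp: U)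
  have left: "m' x = m x" if "x \<le> s" for x
    using that m by (auto simp: m'_def raise_fun_def K_def)
  have right: "m' x = m (x + 1) + 1" if "s \<le> x" "x < ?N" for x
    using that s step[of x] by (auto simp: m'_def raise_fun_def K_def)
  have last: "m' ?N = 0" using ends by (simp add: m'_def raise_fun_def K_def)
  have m': "dyck_fun n m'"
  proof (rule dyck_funI)
    fix x assume x: "- ?N \<le> x" "x < ?N"
    consider "x < s" | "s \<le> x" "x + 1 < ?N" | "s \<le> x" "x + 1 = ?N" using x by linarith
    then show "m' (x + 1) = m' x + 1 \<or> m' (x + 1) = m' x - 1"
    proof cases
      case 1
      then show ?thesis using left[of x] left[of "x + 1"] step[OF x] by simp
    next
      case 2
      then show ?thesis using right[of x] right[of "x + 1"] step[of "x + 1"] x by auto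
    next
      case 3
      then show ?thesis using right[of x] last ends by simp
    qed
  next
    show "m' (- ?N) = 0" using left s ends by simp
  next
    show "0 \<le> m' x" if "- ?N \<le> x" "x \<le> ?N" for x
      using ends(3)[OF that] by (simp add: m'_def raise_fun_def)
  qed (rule last)
  let ?X = "X \<union> (\<lambda>c. {c}) ` columns_on K m"
  have R: "R = tiling_of n l m' ?X"
    unfolding R boxes unfolding U m'_def by (rule add_boxes_tiling_of[OF K])
  show "R \<in> cover_inclusive_tilings n"
    using add_columns[OF ci K] m' unfolding R ci_tiling_of m'_def by blast
  \<comment> \<open>Because of the shift, the step of \<open>m\<close> leaving \<open>x\<close> is
    the step of \<open>m'\<close> entering \<open>x\<close>.\<close>
  have new: "s < x \<and> x \<le> ?N \<and> m' x = m' (x - 1) + 1 \<longleftrightarrow> x \<in> K" for x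
  proof -
    consider "x \<le> s" | "s < x" "x < ?N" | "x = ?N" | "?N < x" by linarith
    then show ?thesis
    proof cases
      case 1
      then show ?thesis using m by (auto simp: K_def)
    next
      case 2
      then show ?thesis using right[of x] right[of "x - 1"] by (auto simp: K_def)
    next
      case 3
      then show ?thesis using last right[of "x - 1"] s ends by (auto simp: K_def)
    qed (auto simp: K_def)
  qed
  have at: "m' x = m x + 2" if "x \<in> K" for x using that by (simp add: m'_def raise_fun_def)
  show "special_column R = s"
    unfolding R
  proof (rule special_columnI)
    show "eligible (tiling_of n l m' ?X) s"
      using s left m top by (auto simp: eligible_tiling_of)
    show "\<not> eligible (tiling_of n l m' ?X) c" if "s < c" for c
      using new[of c] at[of c] that by (auto simp: eligible_tiling_of)
  qed
  have "(x, y) \<in> sgrow_boxes_of_result s R \<longleftrightarrow> x \<in> K \<and> y = m x" for x y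
    using new[of x] at[of x] s by (auto simp: sgrow_boxes_of_result_def R up_step_def)
  then show "sgrow_boxes_of_result s R = sgrow_boxes s U" by (auto simp: boxes)
qed

text \<open>Right of the special column, every up step ends on top of a one-box tile. Removing all
  these tiles moves the upper path one unit right and one unit down, inverse to the shift in
  \<open>sgrow_peaked\<close>.\<close>

lemma sgrow_surj:
  assumes R: "R \<in> cover_inclusive_tilings (Suc n)" and s: "s = special_column R"
  shows "\<exists>U\<in>peaked_tilings (Suc n) s. R = add_boxes (sgrow_boxes s U) U"
proof -
  define N where "N = Suc n"
  obtain l m' X' where R: "R = tiling_of N l m' X'" and ci: "ci_data N l m' X'"
    and el: "eligible (tiling_of N l m' X') s" and sN: "s < int N"
    and up: "\<And>c. s < c \<Longrightarrow> c \<le> int N \<Longrightarrow> m' c = m' (c - 1) + 1 \<Longrightarrow> {(c, m' c - 2)} \<in> X'"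
    using ci_tiling_specialE[OF assms] unfolding N_def by metis
  have s: "- int N < s" "m' s = m' (s - 1) + 1" "{(s, m' s - 2)} \<notin> X'"
    using el by (auto simp: eligible_tiling_of)
  note ciD = ci_dataD[OF ci]
  note step = dyck_fun_step[OF ciD(2)]
  note ends = dyck_fun_ends[OF ciD(2)]
  define K where "K = {x. s < x \<and> x \<le> int N \<and> m' x = m' (x - 1) + 1}"
  define m where "m x = (if x \<in> K then m' x - 2 else m' x)" for x
  have m': "m' = raise_fun K m" by (auto simp: m_def raise_fun_def)
  have tile: "{(x, m x)} \<in> X'" if "x \<in> K" for x using that up by (auto simp: K_def m_def)
  have left: "m x = m' x" if "x \<le> s" for x using that by (auto simp: m_def K_def)
  have right: "m x = m' (x - 1) - 1" if "s < x" "x \<le> int N" for x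
    using that s step[of "x - 1"] by (auto simp: m_def K_def)
  \<comment> \<open>An up step into column \<open>N\<close> would start below the axis, so no box is
    removed there.\<close>
  have last: "m (int N) = 0"
    using ends(2) ends(3)[of "int N - 1"] sN s(1) by (auto simp: m_def K_def)
  have md: "dyck_fun N m"
  proof (rule dyck_funI)
    fix x assume x: "- int N \<le> x" "x < int N"
    consider "x < s" | "x = s" | "s < x" by linarith
    then show "m (x + 1) = m x + 1 \<or> m (x + 1) = m x - 1"
    proof cases
      case 1
      then show ?thesis using left[of x] left[of "x + 1"] step[OF x] by simp
    next
      case 2
      then show ?thesis using left[of x] right[of "x + 1"] x by simp
    next
      case 3
      then show ?thesis using right[of x] right[of "x + 1"] step[of "x - 1"] x s by auto
    qed
  next
    show "m (- int N) = 0" using left s ends by simp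
  next
    show "0 \<le> m x" if x: "- int N \<le> x" "x \<le> int N" for x
    proof (cases "x \<in> K")
      case True
      then have "(x, m x) \<in> region N l m'" using tile ciD(4) by (auto simp: partition_on_def)
      then show ?thesis using dyck_fun_ends(3)[OF ciD(1) x] by (simp add: region_def)
    next
      case False
      then show ?thesis using ends(3)[OF x] by (simp add: m_def)
    qed
  qed (rule last)
  obtain X where X: "ci_data N l m X" "X = X' - (\<lambda>c. {c}) ` columns_on K m"
    and eq: "tiling_of N l m' X' = add_boxes (columns_on K m) (tiling_of N l m X)"
    using remove_columns[OF ci md m' tile] by blast
  have peak: "m (s + 1) = m s - 1" using left[of s] right[of "s + 1"] sN by simp
  have "x \<in> K \<longleftrightarrow> s \<le> x \<and> x < int N \<and> m (x + 1) = m x + 1" for x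
  proof -
    consider "x < s" | "x = s" | "s < x" "x < int N" | "x = int N" | "int N < x" by linarith
    then show ?thesis
    proof cases
      case 3
      then show ?thesis using right[of x] right[of "x + 1"] by (auto simp: K_def)
    next
      case 4
      then show ?thesis using last ends(2) by (auto simp: m_def)
    qed (use peak in \<open>auto simp: K_def\<close>)
  qed
  then have "K = {x. s \<le> x \<and> x < int N \<and> m (x + 1) = m x + 1}" by blast
  then have "sgrow_boxes s (tiling_of N l m X) = columns_on K m"
    using s(1) by (simp add: sgrow_boxes_def up_step_def) force
  moreover have "tiling_of N l m X \<in> peaked_tilings N s"
    using X s sN peak left[of s] left[of "s - 1"]
    by (auto simp: tiling_of_in_peaked_tilings eligible_tiling_of)
  ultimately show ?thesis using eq R unfolding N_def by metis
qed

section \<open>Boxes added along the upper path between \<open>s\<close> and the special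
  column\<close>

definition rgrow_boxes :: "int \<Rightarrow> tiling \<Rightarrow> point set" where
  "rgrow_boxes s U = {(c, h) | c h. (c, h) \<in> upper U \<and> s < c \<and> c < special_column U}"

text \<open>The up step out of \<open>s\<close> shows that boxes were added at all; without it,
  one-box tiles next to \<open>s\<close> come from the spread.\<close>

definition rgrow_boxes_of_result :: "int \<Rightarrow> tiling \<Rightarrow> point set" where
  "rgrow_boxes_of_result s R = {(x, y). s < x \<and> (x, y + 2) \<in> upper R \<and>
     (\<exists>h. up_step (upper R) s h) \<and>
     (\<forall>c. s < c \<and> c \<le> x \<longrightarrow> (\<exists>h. (c, h + 2) \<in> upper R \<and> {(c, h)} \<in> tiles R))}"

text \<open>Raising the path strictly between \<open>s\<close> and \<open>Q\<close> turns the up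
  step into \<open>Q\<close> into a down step. Right of \<open>s\<close> no column is eligible any
  more, and the run of one-box tiles stops at \<open>Q\<close>, whose top box is not a one-box
  tile.\<close>

lemma rgrow_peaked:
  assumes U: "U \<in> peaked_tilings n s" and R: "R = add_boxes (rgrow_boxes s U) U"
  shows "rgrow_boxes s U \<subseteq> upper U" "R \<in> cover_inclusive_tilings n" "special_column R = s"
    "rgrow_boxes_of_result s R = rgrow_boxes s U"
proof -
  let ?N = "int n"
  obtain l m X where U: "U = tiling_of n l m X" and ci: "ci_data n l m X" and s: "- ?N < s" "s < ?N"
    and m: "m (s - 1) = m s - 1" "m (s + 1) = m s - 1" and top: "{(s, m s - 2)} \<notin> X"
    and el: "eligible U s"
    using U by (rule peaked_tilingsE)
  note ciD = ci_dataD[OF ci]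
  note step = dyck_fun_step[OF ciD(2)]
  note ends = dyck_fun_ends[OF ciD(2)]
  define Q where "Q = special_column U"
  note sp = special_columnD[OF el[unfolded U] Q_def[unfolded U]]
  have Q: "Q \<le> ?N" "m Q = m (Q - 1) + 1" "{(Q, m Q - 2)} \<notin> X" "s \<le> Q"
    using sp(1,3) by (auto simp: eligible_tiling_of)
  \<comment> \<open>A down step ends in column \<open>s + 1\<close>, so that column is not eligible;
    if \<open>Q\<close> differs from \<open>s\<close>, at least one box is added.\<close>
  then have Q': "Q = s \<or> s + 1 < Q" using m(2) by (cases "Q = s + 1") auto
  define K where "K = {s<..<Q}"
  define m' where "m' = raise_fun K m"
  have K: "K \<subseteq> {- ?N..?N}" using s Q by (auto simp: K_def)
  have boxes: "rgrow_boxes s U = columns_on K m"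
    using s Q by (auto simp: rgrow_boxes_def Q_def[symmetric] K_def) (auto simp: U)
  then show "rgrow_boxes s U \<subseteq> upper U" using K by (auto simp: U)
  have inside: "m' x = m x + 2" if "s < x" "x < Q" for x
    using that by (simp add: m'_def raise_fun_def K_def)
  have outside: "m' x = m x" if "x \<le> s \<or> Q \<le> x" for x
    using that by (auto simp: m'_def raise_fun_def K_def)
  have m': "dyck_fun n m'"
  proof (rule dyck_funI)
    fix x assume x: "- ?N \<le> x" "x < ?N"
    consider "x + 1 \<le> s \<or> Q \<le> x" | "s < Q" "x = s" | "s < x" "x + 1 < Q" | "s < x" "x + 1 = Q"
      by linarith
    then show "m' (x + 1) = m' x + 1 \<or> m' (x + 1) = m' x - 1"
    proof cases
      case 1
      then show ?thesis using outside[of x] outside[of "x + 1"] step[OF x] by auto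
    next
      case 2
      then show ?thesis using outside[of s] inside[of "s + 1"] Q' m by auto
    next
      case 3
      then show ?thesis using inside[of x] inside[of "x + 1"] step[OF x] by auto
    next
      case 4
      then show ?thesis using inside[of x] outside[of Q] Q(2) by auto
    qed
  next
    show "m' (- ?N) = 0" "m' ?N = 0" using outside s Q(1) ends by auto
  next
    show "0 \<le> m' x" if "- ?N \<le> x" "x \<le> ?N" for x
      using ends(3)[OF that] by (simp add: m'_def raise_fun_def)
  qed
  let ?X = "X \<union> (\<lambda>c. {c}) ` columns_on K m"
  have R: "R = tiling_of n l m' ?X"
    unfolding R boxes unfolding U m'_def by (rule add_boxes_tiling_of[OF K])
  show "R \<in> cover_inclusive_tilings n"
    using add_columns[OF ci K] m' unfolding R ci_tiling_of m'_def by blast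
  show "special_column R = s"
    unfolding R
  proof (rule special_columnI)
    show "eligible (tiling_of n l m' ?X) s"
      using s outside m top by (auto simp: eligible_tiling_of)
    fix c assume "s < c"
    then consider "c < Q" | "s < Q" "c = Q" | "Q < c" by linarith
    then show "\<not> eligible (tiling_of n l m' ?X) c"
    proof cases
      case 1
      then show ?thesis using \<open>s < c\<close> inside[of c] by (auto simp: eligible_tiling_of K_def)
    next
      case 2
      then show ?thesis using Q' Q(2) inside[of "Q - 1"] outside[of Q] by (auto simp: eligible_tiling_of)
    next
      case 3
      then show ?thesis
        using sp(2)[of c] outside[of c] outside[of "c - 1"] by (auto simp: eligible_tiling_of)
    qed
  qed
  have "(x, y) \<in> rgrow_boxes_of_result s R \<longleftrightarrow> x \<in> K \<and> y = m x" for x y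
  proof
    assume L: "(x, y) \<in> rgrow_boxes_of_result s R"
    then have x: "s < x" "y + 2 = m' x" "m' (s + 1) = m' s + 1"
      by (auto simp: rgrow_boxes_of_result_def R up_step_def)
    have run: "{(c, m' c - 2)} \<in> ?X" if c: "s < c" "c \<le> x" for c
    proof -
      obtain h where "(c, h + 2) \<in> upper R" "{(c, h)} \<in> tiles R"
        using L c unfolding rgrow_boxes_of_result_def by blast
      moreover from this(1) have "h = m' c - 2" by (simp add: R)
      ultimately show ?thesis by (simp add: R)
    qed
    have "s < Q" using x(3) m outside[of s] outside[of "s + 1"] Q(4) by (cases "Q = s") auto
    \<comment> \<open>A run reaching \<open>Q\<close> would need a one-box tile below the path
      there, but eligibility of \<open>Q\<close> excludes it from \<open>X\<close> and
      \<open>Q\<close> is not in \<open>K\<close>.\<close>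
    then have "x < Q" using run[of Q] Q(3) outside[of Q] by (cases "Q \<le> x") (auto simp: K_def)
    then show "x \<in> K \<and> y = m x" using x inside[of x] by (auto simp: K_def)
  next
    assume x: "x \<in> K \<and> y = m x"
    then have "m' (s + 1) = m' s + 1" using Q' inside[of "s + 1"] outside[of s] m by (auto simp: K_def)
    moreover have "m' c = m c + 2 \<and> - ?N \<le> c \<and> c \<le> ?N \<and> c \<in> K" if "s < c" "c \<le> x" for c
      using that x inside[of c] s(1) Q(1) by (auto simp: K_def)
    ultimately show "(x, y) \<in> rgrow_boxes_of_result s R"
      using x s by (auto simp: rgrow_boxes_of_result_def R up_step_def K_def)
  qed
  then show "rgrow_boxes_of_result s R = rgrow_boxes s U" by (auto simp: boxes)
qed

text \<open>If a down step leaves \<open>s\<close>, nothing was added. Otherwise the run of one-box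
  tiles starting at \<open>s + 1\<close> is removed; the column \<open>Q\<close> just after it
  becomes the special column.\<close>

lemma rgrow_surj:
  assumes R: "R \<in> cover_inclusive_tilings (Suc n)" and s: "s = special_column R"
  shows "\<exists>U\<in>peaked_tilings (Suc n) s. R = add_boxes (rgrow_boxes s U) U"
proof -
  define N where "N = Suc n"
  obtain l m' X' where R: "R = tiling_of N l m' X'" and ci: "ci_data N l m' X'"
    and el: "eligible (tiling_of N l m' X') s" and sN: "s < int N"
    and up: "\<And>c. s < c \<Longrightarrow> c \<le> int N \<Longrightarrow> m' c = m' (c - 1) + 1 \<Longrightarrow> {(c, m' c - 2)} \<in> X'"
    using ci_tiling_specialE[OF assms] unfolding N_def by metis
  have s': "- int N < s" "m' s = m' (s - 1) + 1" "{(s, m' s - 2)} \<notin> X'"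
    using el by (auto simp: eligible_tiling_of)
  note ciD = ci_dataD[OF ci]
  note step = dyck_fun_step[OF ciD(2)]
  note ends = dyck_fun_ends[OF ciD(2)]
  show ?thesis
  proof (cases "m' (s + 1) = m' s - 1")
    case True
    then have "R \<in> peaked_tilings N s"
      using ci el sN unfolding R by (simp add: tiling_of_in_peaked_tilings)
    moreover have "rgrow_boxes s R = {}" by (auto simp: rgrow_boxes_def s)
    then have "R = add_boxes (rgrow_boxes s R) R" by (simp add: add_boxes_def tiling.expand)
    ultimately show ?thesis unfolding N_def by blast
  next
    case False
    then have su: "m' (s + 1) = m' s + 1" using step[of s] s' sN by auto
    have region: "(x, y) \<in> region N l m'" if "{(x, y)} \<in> X'" for x y
      using that ciD(4) by (auto simp: partition_on_def)
    \<comment> \<open>The predicate marks a break of the run. Natural offsets from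
      \<open>s + 1\<close> allow the first break to be taken with \<open>LEAST\<close>.\<close>
    define P where "P k \<longleftrightarrow> {(s + 1 + int k, m' (s + 1 + int k) - 2)} \<notin> X'" for k
    \<comment> \<open>The run breaks at the latest in column \<open>N\<close>, where a box below the
      upper path would lie below the axis.\<close>
    have "P (nat (int N - s - 1))"
      using region[of "int N" "-2"] ends(2) dyck_fun_ends(2)[OF ciD(1)] sN
      by (auto simp: P_def region_def)
    define Q where "Q = s + 1 + int (LEAST k. P k)"
    have QN: "Q \<le> int N"
      using Least_le[of P, OF \<open>P (nat _)\<close>] sN by (simp add: Q_def)
    have Qt: "{(Q, m' Q - 2)} \<notin> X'"
      using LeastI[of P, OF \<open>P (nat _)\<close>] by (simp add: Q_def P_def)
    have run: "{(c, m' c - 2)} \<in> X'" if "s < c" "c < Q" for c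
      using not_less_Least[of "nat (c - s - 1)" P] that by (simp add: Q_def P_def)
    have "{(s + 1, m' (s + 1) - 2)} \<in> X'" using up[of "s + 1"] su sN by simp
    then have sQ: "s + 1 < Q" using Qt unfolding Q_def by (cases "LEAST k. P k") auto
    \<comment> \<open>An up step into \<open>Q\<close>, being right of the special column, would end
      on a one-box tile, contrary to \<open>Qt\<close>. Lowering column \<open>Q - 1\<close> turns
      this down step into an up step.\<close>
    have Qd: "m' Q = m' (Q - 1) - 1" using up[of Q] Qt QN sQ step[of "Q - 1"] s' by auto
    define K where "K = {s<..<Q}"
    define m where "m x = (if x \<in> K then m' x - 2 else m' x)" for x
    have m': "m' = raise_fun K m" by (auto simp: m_def raise_fun_def)
    have tile: "{(x, m x)} \<in> X'" if "x \<in> K" for x using that run by (auto simp: K_def m_def)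
    have inside: "m x = m' x - 2" if "s < x" "x < Q" for x
      using that by (simp add: m_def K_def)
    have outside: "m x = m' x" if "x \<le> s \<or> Q \<le> x" for x
      using that by (auto simp: m_def K_def)
    have md: "dyck_fun N m"
    proof (rule dyck_funI)
      fix x assume x: "- int N \<le> x" "x < int N"
      consider "x + 1 \<le> s \<or> Q \<le> x" | "x = s" | "s < x" "x + 1 < Q" | "s < x" "x + 1 = Q"
        by linarith
      then show "m (x + 1) = m x + 1 \<or> m (x + 1) = m x - 1"
      proof cases
        case 1
        then show ?thesis using outside[of x] outside[of "x + 1"] step[OF x] by auto
      next
        case 2
        then show ?thesis using outside[of s] inside[of "s + 1"] sQ su by auto
      next
        case 3
        then show ?thesis using inside[of x] inside[of "x + 1"] step[OF x] by auto
      next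
        case 4
        then show ?thesis using inside[of x] outside[of Q] Qd by auto
      qed
    next
      show "m (- int N) = 0" "m (int N) = 0" using outside s' QN ends by auto
    next
      show "0 \<le> m x" if x: "- int N \<le> x" "x \<le> int N" for x
      proof (cases "x \<in> K")
        case True
        then show ?thesis
          using region[OF tile[OF True]] dyck_fun_ends(3)[OF ciD(1) x] by (simp add: region_def)
      next
        case False
        then show ?thesis using ends(3)[OF x] by (simp add: m_def)
      qed
    qed
    obtain X where X: "ci_data N l m X" "X = X' - (\<lambda>c. {c}) ` columns_on K m"
      and eq: "tiling_of N l m' X' = add_boxes (columns_on K m) (tiling_of N l m X)"
      using remove_columns[OF ci md m' tile] by blast
    have "special_column (tiling_of N l m X) = Q"
    proof (rule special_columnI)
      show "eligible (tiling_of N l m X) Q"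
        using QN sQ s' Qt Qd outside[of Q] inside[of "Q - 1"] by (auto simp: eligible_tiling_of X)
      fix c assume "Q < c"
      then show "\<not> eligible (tiling_of N l m X) c"
        using up[of c] outside[of c] outside[of "c - 1"] sQ
        by (auto simp: eligible_tiling_of X K_def)
    qed
    then have "rgrow_boxes s (tiling_of N l m X) = columns_on K m"
      using s' QN by (auto simp: rgrow_boxes_def K_def)
    moreover have "tiling_of N l m X \<in> peaked_tilings N s"
      using X s' sN sQ su outside[of s] outside[of "s - 1"] inside[of "s + 1"]
      by (auto simp: tiling_of_in_peaked_tilings eligible_tiling_of)
    ultimately show ?thesis using eq R unfolding N_def by metis
  qed
qed

section \<open>Iterating a grow map along growth sequences\<close>

lemma growth_sequences_snoc:
  "ps @ [p] \<in> growth_sequences (Suc n) \<longleftrightarrow> ps \<in> growth_sequences n \<and> 0 \<le> p \<and> p \<le> 2 * int n"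
  by (auto simp: growth_sequences_def nth_append less_Suc_eq)

lemma cover_inclusive_tilings_0: "cover_inclusive_tilings 0 = {empty_tiling}"
proof -
  have "T = empty_tiling" if T: "T \<in> cover_inclusive_tilings 0" for T
  proof -
    obtain l m X where T: "T = tiling_of 0 l m X" "ci_data 0 l m X" using T by (rule ci_tilingE)
    have lm: "l 0 = 0" "m 0 = 0" using ci_dataD(1,2)[OF T(2)] by (simp_all add: dyck_fun_def)
    then have "region 0 l m = {}" by (auto simp: region_def)
    then have "X = {}" using ci_dataD(4)[OF T(2)] by (auto simp: partition_on_def)
    then show ?thesis using lm by (auto simp: T(1) tiling_of_def graph_on_def empty_tiling_def)
  qed
  moreover have "empty_tiling = tiling_of 0 (\<lambda>_. 0) (\<lambda>_. 0) {}"
    by (auto simp: tiling_of_def graph_on_def empty_tiling_def)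
  moreover have "ci_data 0 (\<lambda>_. 0) (\<lambda>_. 0) {}"
    by (auto simp: ci_data_def dyck_fun_def unit_steps_def region_def partition_on_def)
  ultimately have "empty_tiling \<in> cover_inclusive_tilings 0" by (metis ci_tiling_of)
  then show ?thesis using \<open>\<And>T. T \<in> _ \<Longrightarrow> _\<close> by blast
qed

text \<open>Induction on the length: splitting off the last entry and subtracting \<open>n\<close>
  turns its range from 0 to \<open>2 * n\<close> into the range of columns from \<open>- n\<close>
  to \<open>n\<close>.\<close>

lemma bij_betw_iterate_grow:
  assumes F: "F [] = empty_tiling" "\<And>ps p. F (ps @ [p]) = g (F ps) (p - int (length ps))"
    and g: "\<And>n. bij_betw (\<lambda>(T, s). g T s) (cover_inclusive_tilings n \<times> {- int n..int n})
      (cover_inclusive_tilings (Suc n))"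
  shows "bij_betw F (growth_sequences n) (cover_inclusive_tilings n)"
proof (induction n)
  case 0
  have "growth_sequences 0 = {[]}" by (auto simp: growth_sequences_def)
  then show ?case using F(1) by (simp add: cover_inclusive_tilings_0 bij_betw_def)
next
  case (Suc n)
  let ?A = "growth_sequences (Suc n)" and ?split = "\<lambda>ps. (butlast ps, last ps - int n)"
  have snoc: "\<exists>qs q. ps = qs @ [q] \<and> length qs = n \<and> qs \<in> growth_sequences n \<and> 0 \<le> q \<and> q \<le> 2 * int n"
    if "ps \<in> ?A" for ps
  proof (cases ps rule: rev_cases)
    case Nil
    then show ?thesis using that by (simp add: growth_sequences_def)
  next
    case (snoc qs q)
    have "qs \<in> growth_sequences n \<and> 0 \<le> q \<and> q \<le> 2 * int n"
      using that unfolding snoc growth_sequences_snoc .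
    moreover from this have "length qs = n" by (simp add: growth_sequences_def)
    ultimately show ?thesis using snoc by blast
  qed
  have "bij_betw ?split ?A (growth_sequences n \<times> {- int n..int n})"
  proof (rule bij_betw_byWitness[of _ "\<lambda>(qs, s). qs @ [s + int n]"])
    show "(\<lambda>(qs, s). qs @ [s + int n]) ` (growth_sequences n \<times> {- int n..int n}) \<subseteq> ?A"
      by (auto simp: growth_sequences_snoc)
    show "\<forall>ps\<in>?A. (\<lambda>(qs, s). qs @ [s + int n]) (?split ps) = ps"
      using snoc by fastforce
    show "?split ` ?A \<subseteq> growth_sequences n \<times> {- int n..int n}"
    proof
      fix x assume "x \<in> ?split ` ?A"
      then obtain ps where ps: "ps \<in> ?A" "x = ?split ps" by blast
      from snoc[OF ps(1)] show "x \<in> growth_sequences n \<times> {- int n..int n}"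
        unfolding ps(2) by force
    qed
  qed auto
  moreover have "bij_betw (map_prod F id) (growth_sequences n \<times> {- int n..int n})
      (cover_inclusive_tilings n \<times> {- int n..int n})"
    using Suc.IH by (intro bij_betw_map_prod) auto
  ultimately have "bij_betw ((\<lambda>(T, s). g T s) \<circ> (map_prod F id \<circ> ?split)) ?A (cover_inclusive_tilings (Suc n))"
    using g by (blast intro: bij_betw_trans)
  then show ?case
  proof (rule bij_betw_cong[THEN iffD1, rotated])
    fix ps assume "ps \<in> ?A"
    then show "((\<lambda>(T, s). g T s) \<circ> (map_prod F id \<circ> ?split)) ps = F ps"
      using snoc F(2) by fastforce
  qed
qed

theorem theorem3:
  fixes n :: nat
  shows "bij_betw DTS (growth_sequences n) (cover_inclusive_tilings n) \<and>
         bij_betw DTR (growth_sequences n) (cover_inclusive_tilings n)"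
proof
  show "bij_betw DTS (growth_sequences n) (cover_inclusive_tilings n)"
  proof (rule bij_betw_iterate_grow)
    show "bij_betw (\<lambda>(T, s). sgrow T s) (cover_inclusive_tilings n \<times> {- int n..int n})
      (cover_inclusive_tilings (Suc n))" for n
    proof (rule bij_betw_grow[where B = sgrow_boxes and C = sgrow_boxes_of_result])
      show "sgrow T s = add_boxes (sgrow_boxes s (spread_tiling s T)) (spread_tiling s T)" for T s
        by (simp add: sgrow_def sgrow_boxes_def Let_def)
    qed (use sgrow_peaked[OF _ refl] sgrow_surj in blast)+
  qed auto
  have empty: "add_boxes {} T = T" for T by (simp add: add_boxes_def)
  \<comment> \<open>When the special column is not right of \<open>s\<close>, the set of boxes is
    empty, so the case distinction in \<open>rgrow\<close> fits the uniform shape required by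
    \<open>bij_betw_grow\<close>.\<close>
  have rgrow: "rgrow T s = add_boxes (rgrow_boxes s (spread_tiling s T)) (spread_tiling s T)" for T s
  proof (cases "s < special_column (spread_tiling s T)")
    case True
    then show ?thesis by (simp add: rgrow_def Let_def rgrow_boxes_def)
  next
    case False
    then have "rgrow_boxes s (spread_tiling s T) = {}" by (auto simp: rgrow_boxes_def)
    then show ?thesis using False by (simp add: rgrow_def Let_def empty)
  qed
  show "bij_betw DTR (growth_sequences n) (cover_inclusive_tilings n)"
  proof (rule bij_betw_iterate_grow)
    show "bij_betw (\<lambda>(T, s). rgrow T s) (cover_inclusive_tilings n \<times> {- int n..int n})
      (cover_inclusive_tilings (Suc n))" for n
      by (rule bij_betw_grow[where B = rgrow_boxes and C = rgrow_boxes_of_result], rule rgrow)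
        (intro conjI rgrow_peaked[OF _ refl], assumption+, rule rgrow_surj)
  qed auto
qed

end
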